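(* Let $\mathcal{A}$ be a Banach algebra, let $P_1$ be an idempotent in the double multiplier algebra $M(\mathcal{A})$, put $P_2=I-P_1$, $\mathcal{A}_{ij}=P_i\mathcal{A}P_j$ $(i,j=1,2)$, $\mathcal{A}_{11}^\circ=\pi(\mathcal{A}_{12}\widehat{\otimes}\mathcal{A}_{21})$ and $\mathcal{A}_{22}^\circ=\pi(\mathcal{A}_{21}\widehat{\otimes}\mathcal{A}_{12})$. Suppose that $\mathcal{A}$ is amenable, that $\mathcal{A}_{11}$ and $\mathcal{A}_{22}$ have trivial virtual centre and that $\mathcal{A}_{21}$ and $\mathcal{A}_{12}$ are not both zero. Then $\mathcal{A}_{jj}=\mathcal{A}_{jj}^\circ$ for at least one value of $j\in\{1,2\}$.
   Context: A double multiplier on a Banach algebra $\mathcal{A}$ is a pair $(L,R)$ of commuting bounded operators on $\mathcal{A}$ with $L(ab)=L(a)b$, $R(ab)=aR(b)$ and $aL(b)=R(a)b$ for all $a,b\in\mathcal{A}$. The set $M(\mathcal{A})$ of double multipliers is a Banach algebra with product $(L_1,R_1)(L_2,R_2)=(L_1L_2,R_2R_1)$ and identity $I$. For $T=(L,R)\in M(\mathcal{A})$ write $Ta=L(a)$, $aT=R(a)$. $\widehat{\otimes}$ is the projective tensor product and $\pi$ is the product map $a\otimes b\mapsto ab$; thus for $j\neq i$, $\mathcal{A}_{ii}^\circ$ is the set of elements $\sum_n a_nb_n$ with $a_n\in\mathcal{A}_{ij}$, $b_n\in\mathcal{A}_{ji}$, $\sum_n\|a_n\|\|b_n\|<\infty$.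 A Banach algebra $\mathcal{B}$ has trivial virtual centre if for each $b^{**}\in\mathcal{B}^{**}$ with $bb^{**}=b^{**}b$ for all $b\in\mathcal{B}$, there is $\lambda\in\mathbb{C}$ with $bb^{**}=\lambda b=b^{**}b$ for all $b\in\mathcal{B}$ (here $\mathcal{B}^{**}$ is the bidual $\mathcal{B}$-bimodule and $\mathcal{B}\subseteq\mathcal{B}^{**}$ canonically). A Banach algebra $\mathcal{A}$ is amenable if for every Banach $\mathcal{A}$-bimodule $Z$, every continuous derivation $D:\mathcal{A}\to Z^*$ is inner, i.e. of the form $a\mapsto a\cdot z^*-z^*\cdot a$ for some $z^*\in Z^*$. Here $Z^*$ carries the dual module actions $\langle a\cdot z^*,z\rangle=\langle z^*,z\cdot a\rangle$, $\langle z^*\cdot a,z\rangle=\langle z^*,a\cdot z\rangle$, and a derivation is a linear map with $D(ab)=a\cdot D(b)+D(a)\cdot b$. *)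

theory Defs
  imports "HOL-Analysis.Analysis"
begin

text \<open>Complex Banach algebras. They need not have an identity; the norm is submultiplicative
  (this is part of \<^class>\<open>real_normed_algebra\<close>).\<close>

class scaleC =
  fixes scaleC :: "complex \<Rightarrow> 'a \<Rightarrow> 'a"  (infixr "*\<^sub>C" 75)

class complex_banach_algebra = scaleC + real_normed_algebra + banach +
  assumes scaleC_add_right: "c *\<^sub>C (x + y) = c *\<^sub>C x + c *\<^sub>C y"
    and scaleC_add_left: "(c + d) *\<^sub>C x = c *\<^sub>C x + d *\<^sub>C x"
    and scaleC_scaleC: "c *\<^sub>C (d *\<^sub>C x) = (c * d) *\<^sub>C x"
    and scaleR_scaleC: "scaleR r x = complex_of_real r *\<^sub>C x"
    and mult_scaleC_left: "(c *\<^sub>C x) * y = c *\<^sub>C (x * y)"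
    and mult_scaleC_right: "x * (c *\<^sub>C y) = c *\<^sub>C (x * y)"
    and norm_scaleC: "norm (c *\<^sub>C x) = cmod c * norm x"


section \<open>Double multipliers\<close>

definition bounded_clinear_op :: "('a::complex_banach_algebra \<Rightarrow> 'a) \<Rightarrow> bool" where
  "bounded_clinear_op T \<longleftrightarrow> bounded_linear T \<and> (\<forall>c x. T (c *\<^sub>C x) = c *\<^sub>C T x)"

type_synonym 'a dmult = "('a \<Rightarrow> 'a) \<times> ('a \<Rightarrow> 'a)"

definition double_multipliers :: "'a::complex_banach_algebra dmult set" where
  "double_multipliers = {(L, R). bounded_clinear_op L \<and> bounded_clinear_op R \<and> L \<circ> R = R \<circ> L \<and>
     (\<forall>a b. L (a * b) = L a * b \<and> R (a * b) = a * R b \<and> a * L b = R a * b)}"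

definition dm_mult :: "'a dmult \<Rightarrow> 'a dmult \<Rightarrow> 'a dmult" where
  "dm_mult S T = (fst S \<circ> fst T, snd T \<circ> snd S)"

definition dm_one :: "'a dmult" where
  "dm_one = (id, id)"

definition dm_minus :: "'a::complex_banach_algebra dmult \<Rightarrow> 'a dmult \<Rightarrow> 'a dmult" where
  "dm_minus S T = ((\<lambda>a. fst S a - fst T a), (\<lambda>a. snd S a - snd T a))"

text \<open>\<open>corner P Q\<close> is \<open>P A Q\<close>, where \<open>P a = fst P a\<close> and \<open>a Q = snd Q a\<close>.\<close>

definition corner :: "'a dmult \<Rightarrow> 'a dmult \<Rightarrow> 'a set" where
  "corner P Q = {fst P (snd Q a) | a. True}"

text \<open>\<open>proj_image X Y\<close> is the image of the projective tensor product of \<open>X\<close> and \<open>Y\<close> under the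
  product map; every element of that tensor product is an absolutely convergent series of
  elementary tensors.\<close>

definition proj_image :: "'a::complex_banach_algebra set \<Rightarrow> 'a set \<Rightarrow> 'a set" where
  "proj_image X Y = {\<Sum>n. a n * b n | a b :: nat \<Rightarrow> 'a.
     (\<forall>n. a n \<in> X) \<and> (\<forall>n. b n \<in> Y) \<and> summable (\<lambda>n. norm (a n) * norm (b n))}"


section \<open>Banach bimodules\<close>

text \<open>Below, \<open>B\<close> is a closed subalgebra of the ambient Banach algebra \<open>'a\<close>, with the inherited
  norm (possibly \<^term>\<open>UNIV\<close>).  Modules have an explicit carrier, so that one may quantify over
  them; the operations are only relevant on \<open>B\<close> and on the carrier.\<close>

record ('a, 'z) bimod =
  bm_carrier :: "'z set"
  bm_zero :: 'z
  bm_add :: "'z \<Rightarrow> 'z \<Rightarrow> 'z"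
  bm_scale :: "complex \<Rightarrow> 'z \<Rightarrow> 'z"
  bm_norm :: "'z \<Rightarrow> real"
  bm_lact :: "'a \<Rightarrow> 'z \<Rightarrow> 'z"
  bm_ract :: "'z \<Rightarrow> 'a \<Rightarrow> 'z"

definition bm_minus :: "('a, 'z) bimod \<Rightarrow> 'z \<Rightarrow> 'z \<Rightarrow> 'z" where
  "bm_minus M x y = bm_add M x (bm_scale M (- 1) y)"

locale banach_bimodule =
  fixes B :: "'a::complex_banach_algebra set" and M :: "('a, 'z) bimod"
  assumes zero_closed: "bm_zero M \<in> bm_carrier M"
    and add_closed: "\<lbrakk>x \<in> bm_carrier M; y \<in> bm_carrier M\<rbrakk> \<Longrightarrow> bm_add M x y \<in> bm_carrier M"
    and scale_closed: "x \<in> bm_carrier M \<Longrightarrow> bm_scale M c x \<in> bm_carrier M"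
    and lact_closed: "\<lbrakk>a \<in> B; x \<in> bm_carrier M\<rbrakk> \<Longrightarrow> bm_lact M a x \<in> bm_carrier M"
    and ract_closed: "\<lbrakk>a \<in> B; x \<in> bm_carrier M\<rbrakk> \<Longrightarrow> bm_ract M x a \<in> bm_carrier M"
    and add_assoc: "\<lbrakk>x \<in> bm_carrier M; y \<in> bm_carrier M; z \<in> bm_carrier M\<rbrakk>
      \<Longrightarrow> bm_add M (bm_add M x y) z = bm_add M x (bm_add M y z)"
    and add_commute: "\<lbrakk>x \<in> bm_carrier M; y \<in> bm_carrier M\<rbrakk> \<Longrightarrow> bm_add M x y = bm_add M y x"
    and add_zero: "x \<in> bm_carrier M \<Longrightarrow> bm_add M (bm_zero M) x = x"
    and minus_self: "x \<in> bm_carrier M \<Longrightarrow> bm_minus M x x = bm_zero M"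
    and scale_add_right: "\<lbrakk>x \<in> bm_carrier M; y \<in> bm_carrier M\<rbrakk>
      \<Longrightarrow> bm_scale M c (bm_add M x y) = bm_add M (bm_scale M c x) (bm_scale M c y)"
    and scale_add_left: "x \<in> bm_carrier M
      \<Longrightarrow> bm_scale M (c + d) x = bm_add M (bm_scale M c x) (bm_scale M d x)"
    and scale_scale: "x \<in> bm_carrier M \<Longrightarrow> bm_scale M c (bm_scale M d x) = bm_scale M (c * d) x"
    and scale_one: "x \<in> bm_carrier M \<Longrightarrow> bm_scale M 1 x = x"
    and norm_nonneg: "x \<in> bm_carrier M \<Longrightarrow> 0 \<le> bm_norm M x"
    and norm_eq_zero: "x \<in> bm_carrier M \<Longrightarrow> bm_norm M x = 0 \<longleftrightarrow> x = bm_zero M"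
    and norm_triangle: "\<lbrakk>x \<in> bm_carrier M; y \<in> bm_carrier M\<rbrakk>
      \<Longrightarrow> bm_norm M (bm_add M x y) \<le> bm_norm M x + bm_norm M y"
    and norm_scale: "x \<in> bm_carrier M \<Longrightarrow> bm_norm M (bm_scale M c x) = cmod c * bm_norm M x"
    and complete: "\<lbrakk>\<And>n. s n \<in> bm_carrier M;
        \<And>e. e > 0 \<Longrightarrow> \<exists>N. \<forall>m\<ge>N. \<forall>n\<ge>N. bm_norm M (bm_minus M (s m) (s n)) < e\<rbrakk>
      \<Longrightarrow> \<exists>l\<in>bm_carrier M. (\<lambda>n. bm_norm M (bm_minus M (s n) l)) \<longlonglongrightarrow> 0"
    and lact_add_left: "\<lbrakk>a \<in> B; b \<in> B; x \<in> bm_carrier M\<rbrakk>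
      \<Longrightarrow> bm_lact M (a + b) x = bm_add M (bm_lact M a x) (bm_lact M b x)"
    and lact_add_right: "\<lbrakk>a \<in> B; x \<in> bm_carrier M; y \<in> bm_carrier M\<rbrakk>
      \<Longrightarrow> bm_lact M a (bm_add M x y) = bm_add M (bm_lact M a x) (bm_lact M a y)"
    and lact_scale_left: "\<lbrakk>a \<in> B; x \<in> bm_carrier M\<rbrakk>
      \<Longrightarrow> bm_lact M (c *\<^sub>C a) x = bm_scale M c (bm_lact M a x)"
    and lact_scale_right: "\<lbrakk>a \<in> B; x \<in> bm_carrier M\<rbrakk>
      \<Longrightarrow> bm_lact M a (bm_scale M c x) = bm_scale M c (bm_lact M a x)"
    and ract_add_left: "\<lbrakk>a \<in> B; x \<in> bm_carrier M; y \<in> bm_carrier M\<rbrakk>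
      \<Longrightarrow> bm_ract M (bm_add M x y) a = bm_add M (bm_ract M x a) (bm_ract M y a)"
    and ract_add_right: "\<lbrakk>a \<in> B; b \<in> B; x \<in> bm_carrier M\<rbrakk>
      \<Longrightarrow> bm_ract M x (a + b) = bm_add M (bm_ract M x a) (bm_ract M x b)"
    and ract_scale_left: "\<lbrakk>a \<in> B; x \<in> bm_carrier M\<rbrakk>
      \<Longrightarrow> bm_ract M (bm_scale M c x) a = bm_scale M c (bm_ract M x a)"
    and ract_scale_right: "\<lbrakk>a \<in> B; x \<in> bm_carrier M\<rbrakk>
      \<Longrightarrow> bm_ract M x (c *\<^sub>C a) = bm_scale M c (bm_ract M x a)"
    and lact_mult: "\<lbrakk>a \<in> B; b \<in> B; x \<in> bm_carrier M\<rbrakk>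
      \<Longrightarrow> bm_lact M (a * b) x = bm_lact M a (bm_lact M b x)"
    and ract_mult: "\<lbrakk>a \<in> B; b \<in> B; x \<in> bm_carrier M\<rbrakk>
      \<Longrightarrow> bm_ract M x (a * b) = bm_ract M (bm_ract M x a) b"
    and lact_ract: "\<lbrakk>a \<in> B; b \<in> B; x \<in> bm_carrier M\<rbrakk>
      \<Longrightarrow> bm_ract M (bm_lact M a x) b = bm_lact M a (bm_ract M x b)"
    and act_bounded: "\<exists>K. \<forall>a\<in>B. \<forall>x\<in>bm_carrier M.
      bm_norm M (bm_lact M a x) \<le> K * norm a * bm_norm M x \<and>
      bm_norm M (bm_ract M x a) \<le> K * norm a * bm_norm M x"

text \<open>The dual bimodule.  Functionals are normalised to be \<^const>\<open>undefined\<close> off the carrier of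
  \<open>M\<close>, so that equality of functions is equality of functionals.\<close>

definition bm_dual :: "('a, 'z) bimod \<Rightarrow> ('a, 'z \<Rightarrow> complex) bimod" where
  "bm_dual M = \<lparr>
     bm_carrier = {f \<in> extensional (bm_carrier M).
       (\<forall>x\<in>bm_carrier M. \<forall>y\<in>bm_carrier M. f (bm_add M x y) = f x + f y) \<and>
       (\<forall>c. \<forall>x\<in>bm_carrier M. f (bm_scale M c x) = c * f x) \<and>
       (\<exists>K. \<forall>x\<in>bm_carrier M. cmod (f x) \<le> K * bm_norm M x)},
     bm_zero = (\<lambda>x\<in>bm_carrier M. 0),
     bm_add = (\<lambda>f g. \<lambda>x\<in>bm_carrier M. f x + g x),
     bm_scale = (\<lambda>c f. \<lambda>x\<in>bm_carrier M. c * f x),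
     bm_norm = (\<lambda>f. SUP x\<in>{x \<in> bm_carrier M. bm_norm M x \<le> 1}. cmod (f x)),
     bm_lact = (\<lambda>a f. \<lambda>x\<in>bm_carrier M. f (bm_ract M x a)),
     bm_ract = (\<lambda>f a. \<lambda>x\<in>bm_carrier M. f (bm_lact M a x))\<rparr>"

definition bm_self :: "'a::complex_banach_algebra set \<Rightarrow> ('a, 'a) bimod" where
  "bm_self B = \<lparr>bm_carrier = B, bm_zero = 0, bm_add = (+), bm_scale = (*\<^sub>C), bm_norm = norm,
     bm_lact = (*), bm_ract = (*)\<rparr>"

definition bm_canonical :: "('a, 'z) bimod \<Rightarrow> 'z \<Rightarrow> (('z \<Rightarrow> complex) \<Rightarrow> complex)" where
  "bm_canonical M x = (\<lambda>f\<in>bm_carrier (bm_dual M). f x)"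


section \<open>Trivial virtual centre and amenability\<close>

definition trivial_virtual_centre :: "'a::complex_banach_algebra set \<Rightarrow> bool" where
  "trivial_virtual_centre B \<longleftrightarrow>
    (let S = bm_self B; BB = bm_dual (bm_dual S) in
     \<forall>\<Phi>\<in>bm_carrier BB. (\<forall>b\<in>B. bm_lact BB b \<Phi> = bm_ract BB \<Phi> b) \<longrightarrow>
       (\<exists>c. \<forall>b\<in>B. bm_lact BB b \<Phi> = bm_canonical S (c *\<^sub>C b) \<and>
                  bm_ract BB \<Phi> b = bm_canonical S (c *\<^sub>C b)))"

definition dual_derivation ::
  "'a::complex_banach_algebra set \<Rightarrow> ('a, 'z) bimod \<Rightarrow> ('a \<Rightarrow> 'z \<Rightarrow> complex) \<Rightarrow> bool" where
  "dual_derivation B M D \<longleftrightarrow>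
    (let N = bm_dual M in
     (\<forall>a\<in>B. D a \<in> bm_carrier N) \<and>
     (\<forall>a\<in>B. \<forall>b\<in>B. D (a + b) = bm_add N (D a) (D b)) \<and>
     (\<forall>c. \<forall>a\<in>B. D (c *\<^sub>C a) = bm_scale N c (D a)) \<and>
     (\<forall>a\<in>B. \<forall>b\<in>B. D (a * b) = bm_add N (bm_lact N a (D b)) (bm_ract N (D a) b)) \<and>
     (\<exists>K. \<forall>a\<in>B. bm_norm N (D a) \<le> K * norm a))"

definition inner_dual_derivation ::
  "'a::complex_banach_algebra set \<Rightarrow> ('a, 'z) bimod \<Rightarrow> ('a \<Rightarrow> 'z \<Rightarrow> complex) \<Rightarrow> bool" where
  "inner_dual_derivation B M D \<longleftrightarrow>
    (let N = bm_dual M in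
     \<exists>\<phi>\<in>bm_carrier N. \<forall>a\<in>B. D a = bm_minus N (bm_lact N a \<phi>) (bm_ract N \<phi> a))"

text \<open>HOL cannot quantify over all types, so the bimodules range over those whose underlying set is
  a subset of the type \<open>'a \<Rightarrow> complex\<close>.  This loses nothing.  A Banach space generated as a Banach
  \<open>B\<close>-bimodule by countably many elements has at most \<open>|'a|\<^sup>\<aleph>\<^sup>0\<close> elements, and the type has at
  least that many (the case \<open>B = {0}\<close> being trivial), so every countably generated Banach bimodule
  is isometrically isomorphic to one considered here.  Now let \<open>D\<close> be a bounded derivation into
  the dual of an arbitrary Banach bimodule \<open>Z\<close> and suppose that its restriction to each countably
  generated closed submodule \<open>Y\<close> is implemented by a functional on \<open>Y\<close>, of least norm \<open>c(Y)\<close> say.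
  Then \<open>c\<close> is monotone, hence bounded, since countably many \<open>Y\<close> lie in a single one; a weak*
  limit point of Hahn-Banach extensions of the implementing functionals implements \<open>D\<close> on \<open>Z\<close>.\<close>

definition amenable :: "'a::complex_banach_algebra set \<Rightarrow> bool" where
  "amenable B \<longleftrightarrow> (\<forall>M :: ('a, 'a \<Rightarrow> complex) bimod. banach_bimodule B M \<longrightarrow>
     (\<forall>D. dual_derivation B M D \<longrightarrow> inner_dual_derivation B M D))"

end

theory Submission
  imports Defs
begin

text \<open>
  Write \<open>P\<close> for the given idempotent, \<open>Q\<close> for its complement and \<open>A\<close> for the algebra.  The map
  \<open>a \<mapsto> a P - P a\<close> is a derivation whose values have no diagonal part, so it takes its values in the
  ideal \<open>J = PAQ + QAP + span (PAQ QAP) + span (QAP PAQ)\<close>.  On \<open>J\<close> put a norm that measures sums of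
  products by the projective norm; both multiplications by elements of \<open>A\<close> stay bounded
  (\<open>acting_pair_odd\<close>).  The dual of \<open>J\<close> is a Banach bimodule, and amenability, applied to this module,
  provides \<open>\<Theta>\<close> in the bidual of \<open>J\<close> with \<open>a P - P a = a \<Theta> - \<Theta> a\<close> (\<open>amenable_implements\<close>).  Since \<open>J\<close>
  consists of elements of \<open>A\<close>, its functionals are functions on a subset of \<open>A\<close>, and the module is one
  over which the definition of amenability quantifies.

  The derivation vanishes on \<open>PAP\<close> and on \<open>QAQ\<close>, so the compressions of \<open>\<Theta>\<close> to these corners commute
  with them.  Because the virtual centres are trivial, the compressions act as scalars \<open>c1\<close> and \<open>c2\<close>
  (\<open>virtual_centre_scalar\<close>).

  Suppose that \<open>c1\<close> is not zero.  Each \<open>y\<close> in \<open>PAP\<close> is a multiple of \<open>y \<Theta>\<close>, and the compression of \<open>\<Theta>\<close>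
  comes from the bidual of the projective tensor product of \<open>PAQ\<close> and \<open>QAP\<close>.  The product map from
  that tensor product to \<open>PAP\<close> is therefore onto after passing to biduals, with control of norms, and
  hence onto.  In \<open>corner11_subset_proj_image\<close> this is made concrete with the Hahn--Banach theorem for a
  gauge between the projective norm and the norm of \<open>A\<close>, followed by the iteration of the open mapping
  theorem (\<open>proj_image_if_gauge_norm_bounded\<close>).  If \<open>c2\<close> is not zero, the same argument applies to \<open>QAQ\<close>.

  If both scalars are zero, then for \<open>a\<close> in \<open>PAQ\<close> the equation reads \<open>- a = a \<Theta> - \<Theta> a\<close>, and tested on
  functionals that live on \<open>PAQ\<close> both terms on the right vanish (\<open>\<Theta>_annihilates_corner12\<close>).  This uses
  a weak form of approximate identities, again obtained from amenability.  So \<open>PAQ\<close> is zero, and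
  in the same way \<open>QAP\<close> is zero, which the hypotheses exclude.
\<close>

section \<open>The Hahn--Banach theorem\<close>

definition sublinear :: "('v::real_vector \<Rightarrow> real) \<Rightarrow> bool" where
  "sublinear q \<longleftrightarrow> (\<forall>x y. q (x + y) \<le> q x + q y) \<and> (\<forall>r\<ge>0. \<forall>x. q (r *\<^sub>R x) \<le> r * q x)"

lemma sublinear_add: "sublinear q \<Longrightarrow> q (x + y) \<le> q x + q y"
  by (simp add: sublinear_def)

lemma sublinear_zero: assumes "sublinear q" shows "q 0 = 0"
proof -
  have "q (0 *\<^sub>R 0) \<le> 0 * q 0" using assms unfolding sublinear_def by blast
  moreover have "q (0 + 0) \<le> q 0 + q 0" using assms sublinear_add by blast
  ultimately show ?thesis by simp
qed

lemma sublinear_scaleR: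
  assumes "sublinear q" "0 \<le> r" shows "q (r *\<^sub>R x) = r * q x"
proof (cases "r = 0")
  case True
  then show ?thesis using sublinear_zero[OF assms(1)] by simp
next
  case False
  have "q (inverse r *\<^sub>R (r *\<^sub>R x)) \<le> inverse r * q (r *\<^sub>R x)"
    using assms unfolding sublinear_def by (meson inverse_nonnegative_iff_nonnegative)
  then have "r * q x \<le> q (r *\<^sub>R x)"
    using False assms(2) by (simp add: field_simps)
  then show ?thesis using assms unfolding sublinear_def by (meson order_antisym)
qed

lemma sublinear_lower: assumes "sublinear q" shows "- q (- x) \<le> q x"
  using sublinear_add[OF assms, of x "- x"] sublinear_zero[OF assms] by simp

text \<open>Compare \<open>q\<close> along the ray in direction \<open>y\<close>: the infimum over \<open>t \<ge> 0\<close> of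
  \<open>q (x + t y) - t q y\<close> is again sublinear, and \<open>t = 0\<close>, \<open>t = 1\<close> give the two upper bounds.  The
  value of the new functional at \<open>- y\<close> is at most \<open>- q y\<close>, so this step removes the failure of
  additivity in the direction \<open>y\<close>.\<close>

lemma sublinear_improve:
  assumes q: "sublinear q"
  obtains q' where "sublinear q'" "q' \<le> q" "\<And>x. q' x \<le> q (x + y) - q y"
proof
  define q' where "q' x = (INF t\<in>{0..}. q (x + t *\<^sub>R y) - t * q y)" for x
  have bdd: "bdd_below ((\<lambda>t. q (x + t *\<^sub>R y) - t * q y) ` {0..})" for x
  proof (rule bdd_belowI2)
    fix t :: real assume t: "t \<in> {0..}"
    have "q (t *\<^sub>R y) \<le> q (x + t *\<^sub>R y) + q (- x)"
      using sublinear_add[OF q, of "x + t *\<^sub>R y" "- x"] by simp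
    then show "- q (- x) \<le> q (x + t *\<^sub>R y) - t * q y"
      using sublinear_scaleR[OF q] t by simp
  qed
  have le: "q' x \<le> q (x + t *\<^sub>R y) - t * q y" if "0 \<le> t" for x t
    unfolding q'_def by (rule cINF_lower[OF bdd]) (use that in simp)
  have greatest: "m \<le> q' x" if "\<And>t. 0 \<le> t \<Longrightarrow> m \<le> q (x + t *\<^sub>R y) - t * q y" for m x
    unfolding q'_def by (rule cINF_greatest) (use that in auto)
  show "q' \<le> q"
    using le[of 0] by (auto simp: le_fun_def)
  show "q' x \<le> q (x + y) - q y" for x
    using le[of 1 x] by simp
  have add: "q' (x1 + x2) \<le> q' x1 + q' x2" for x1 x2
  proof -
    have "q' (x1 + x2) - (q (x2 + t2 *\<^sub>R y) - t2 * q y) \<le> q (x1 + t1 *\<^sub>R y) - t1 * q y"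
      if "0 \<le> t1" "0 \<le> t2" for t1 t2
    proof -
      have "q' (x1 + x2) \<le> q ((x1 + t1 *\<^sub>R y) + (x2 + t2 *\<^sub>R y)) - (t1 + t2) * q y"
        using le[of "t1 + t2" "x1 + x2"] that by (simp add: algebra_simps)
      also have "\<dots> \<le> q (x1 + t1 *\<^sub>R y) + q (x2 + t2 *\<^sub>R y) - (t1 + t2) * q y"
        using sublinear_add[OF q] by (simp add: diff_right_mono)
      finally show ?thesis by (simp add: algebra_simps)
    qed
    then have "q' (x1 + x2) - (q (x2 + t2 *\<^sub>R y) - t2 * q y) \<le> q' x1" if "0 \<le> t2" for t2
      using that greatest by blast
    then have "q' (x1 + x2) - q' x1 \<le> q' x2"
      by (intro greatest) (simp add: algebra_simps)
    then show ?thesis by simp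
  qed
  have scale: "q' (s *\<^sub>R x) \<le> s * q' x" if "0 \<le> s" for s x
  proof (cases "s = 0")
    case True
    have "q' 0 \<le> 0" using le[of 0 0] sublinear_zero[OF q] by simp
    with True show ?thesis by simp
  next
    case False
    with that have s: "s > 0" by simp
    have "q' (s *\<^sub>R x) / s \<le> q' x"
    proof (rule greatest)
      fix t :: real assume t: "0 \<le> t"
      have "q' (s *\<^sub>R x) \<le> q (s *\<^sub>R (x + t *\<^sub>R y)) - (s * t) * q y"
        using le[of "s * t" "s *\<^sub>R x"] t s by (simp add: scaleR_add_right)
      also have "\<dots> = s * (q (x + t *\<^sub>R y) - t * q y)"
        using sublinear_scaleR[OF q, of s] s by (simp add: right_diff_distrib)
      finally show "q' (s *\<^sub>R x) / s \<le> q (x + t *\<^sub>R y) - t * q y"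
        using s by (simp add: field_simps)
    qed
    then show ?thesis using s by (simp add: field_simps)
  qed
  show "sublinear q'" unfolding sublinear_def using add scale by blast
qed

text \<open>Zorn's lemma: the pointwise infimum of a chain of sublinear functionals below \<open>p\<close> is finite,
  because each of them is at least \<open>- p (- x)\<close> at \<open>x\<close>.\<close>

lemma minimal_sublinear:
  assumes p: "sublinear p"
  obtains q where "sublinear q" "q \<le> p" "\<And>q'. sublinear q' \<Longrightarrow> q' \<le> q \<Longrightarrow> q' = q"
proof -
  let ?S = "{q. sublinear q \<and> q \<le> p}"
  let ?R = "relation_of (\<lambda>q q'. q' \<le> q) ?S"
  have po: "partial_order_on ?S ?R"
    by (rule partial_order_on_relation_ofI) auto
  have "\<exists>q\<in>?S. \<forall>q'\<in>C. q \<le> q'" if C: "C \<in> Chains ?R" for C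
  proof (cases "C = {}")
    case True
    then show ?thesis using p by auto
  next
    case ne: False
    have CS: "C \<subseteq> ?S" using C by (auto simp: Chains_def relation_of_def)
    have tot: "q \<le> q' \<or> q' \<le> q" if "q \<in> C" "q' \<in> C" for q q'
      using C that by (auto simp: Chains_def relation_of_def)
    define m where "m x = (INF q\<in>C. q x)" for x
    have bdd: "bdd_below ((\<lambda>q. q x) ` C)" for x
    proof (rule bdd_belowI2)
      fix q assume "q \<in> C"
      with CS have "sublinear q" "q (- x) \<le> p (- x)" by (auto simp: le_fun_def)
      with sublinear_lower[of q x] show "- p (- x) \<le> q x" by linarith
    qed
    have le: "m x \<le> q x" if "q \<in> C" for q x
      unfolding m_def by (rule cINF_lower[OF bdd that])
    have greatest: "k \<le> m x" if "\<And>q. q \<in> C \<Longrightarrow> k \<le> q x" for k x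
      unfolding m_def by (rule cINF_greatest[OF ne that])
    have add: "m (x + y) \<le> m x + m y" for x y
    proof -
      have "m (x + y) - q' y \<le> q x" if qC: "q \<in> C" "q' \<in> C" for q q'
      proof -
        obtain q0 where q0: "q0 \<in> C" "q0 \<le> q" "q0 \<le> q'"
          using tot[OF qC] qC by blast
        have "m (x + y) \<le> q0 (x + y)" using le q0 by blast
        also have "\<dots> \<le> q0 x + q0 y" using q0(1) CS by (auto intro: sublinear_add)
        also have "\<dots> \<le> q x + q' y" using q0 by (simp add: le_fun_def add_mono)
        finally show ?thesis by simp
      qed
      then have "m (x + y) - q' y \<le> m x" if "q' \<in> C" for q'
        using that greatest by blast
      then have "m (x + y) - m x \<le> m y"
        by (intro greatest) (simp add: algebra_simps)
      then show ?thesis by simp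
    qed
    have scale: "m (r *\<^sub>R x) \<le> r * m x" if r: "0 \<le> r" for r x
    proof (cases "r = 0")
      case True
      obtain q where "q \<in> C" using ne by blast
      with le[of q 0] CS have "m 0 \<le> 0" using sublinear_zero by fastforce
      with True show ?thesis by simp
    next
      case False
      with r have r': "r > 0" by simp
      have "m (r *\<^sub>R x) / r \<le> m x"
      proof (rule greatest)
        fix q assume q: "q \<in> C"
        with CS have "sublinear q" by auto
        with le[OF q, of "r *\<^sub>R x"] show "m (r *\<^sub>R x) / r \<le> q x"
          using r' by (simp add: sublinear_scaleR field_simps)
      qed
      then show ?thesis using r' by (simp add: field_simps)
    qed
    have "sublinear m" unfolding sublinear_def using add scale by blast
    moreover have "m \<le> p"
    proof (rule le_funI)
      fix x
      obtain q where "q \<in> C" using ne by blast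
      with le[of q x] CS show "m x \<le> p x" by (auto simp: le_fun_def intro: order_trans)
    qed
    ultimately show ?thesis using le by (auto simp: le_fun_def)
  qed
  then have "\<exists>m\<in>?S. \<forall>a\<in>?S. a \<le> m \<longrightarrow> a = m"
    using predicate_Zorn[OF po] by blast
  then show ?thesis using that by (metis (mono_tags, lifting) mem_Collect_eq order_trans)
qed

text \<open>A minimal sublinear functional is linear, since it cannot be improved in any direction \<open>y\<close> and
  is therefore superadditive.  To reach \<open>p x0\<close> at \<open>x0\<close>, improve \<open>p\<close> in the direction \<open>x0\<close> before
  passing to a minimal functional.\<close>

theorem Hahn_Banach_real:
  assumes p: "sublinear p"
  obtains u where "linear u" "u \<le> p" "u x0 = p x0"
proof -
  obtain p' where p': "sublinear p'" "p' \<le> p" "\<And>x. p' x \<le> p (x + x0) - p x0"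
    using sublinear_improve[OF p] by blast
  obtain u where u: "sublinear u" "u \<le> p'" and min: "\<And>q. sublinear q \<Longrightarrow> q \<le> u \<Longrightarrow> q = u"
    using minimal_sublinear[OF p'(1)] by blast
  have add: "u (x + y) = u x + u y" for x y
  proof -
    obtain q where "sublinear q" "q \<le> u" "\<And>x. q x \<le> u (x + y) - u y"
      using sublinear_improve[OF u(1)] by blast
    with min have "u x \<le> u (x + y) - u y" by blast
    with sublinear_add[OF u(1), of x y] show ?thesis by simp
  qed
  have neg: "u (- x) = - u x" for x
    using add[of x "- x"] sublinear_zero[OF u(1)] by simp
  have "u (r *\<^sub>R x) = r * u x" for r x
  proof (cases "0 \<le> r")
    case False
    then have "u ((- r) *\<^sub>R x) = - r * u x" using sublinear_scaleR[OF u(1), of "- r"] by simp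
    with neg[of "r *\<^sub>R x"] show ?thesis by simp
  qed (use sublinear_scaleR[OF u(1)] in simp)
  with add have "linear u" by (intro linearI) auto
  moreover have "u \<le> p" using u(2) p'(2) by order
  moreover have "u x0 = p x0"
  proof -
    have "u (- x0) \<le> p (- x0 + x0) - p x0"
      using u(2) p'(3)[of "- x0"] by (meson le_funD order_trans)
    then have "p x0 \<le> u x0" using neg sublinear_zero[OF p] by simp
    with \<open>u \<le> p\<close> show ?thesis by (meson le_funD order_antisym)
  qed
  ultimately show ?thesis using that by blast
qed

lemma scaleC_one [simp]: "1 *\<^sub>C x = (x::'a::complex_banach_algebra)"
  using scaleR_scaleC[of 1 x] by simp

lemma scaleC_zero_left [simp]: "0 *\<^sub>C x = (0::'a::complex_banach_algebra)"
  using scaleR_scaleC[of 0 x] by simp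

lemma scaleC_zero_right [simp]: "c *\<^sub>C 0 = (0::'a::complex_banach_algebra)"
  using scaleC_add_right[of c 0 0] by simp

lemma scaleC_minus_one: "(- 1) *\<^sub>C x = - (x::'a::complex_banach_algebra)"
  using scaleR_scaleC[of "-1" x] by simp

lemma scaleC_minus_right: "c *\<^sub>C (- x) = - (c *\<^sub>C (x::'a::complex_banach_algebra))"
  by (metis mult.commute scaleC_minus_one scaleC_scaleC)

definition complex_linear :: "('a::complex_banach_algebra \<Rightarrow> complex) \<Rightarrow> bool" where
  "complex_linear f \<longleftrightarrow> (\<forall>x y. f (x + y) = f x + f y) \<and> (\<forall>c x. f (c *\<^sub>C x) = c * f x)"

text \<open>The usual complexification \<open>x \<mapsto> u x - i u (i x)\<close> of a real functional \<open>u\<close>.\<close>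

theorem Hahn_Banach_complex:
  fixes p :: "'a::complex_banach_algebra \<Rightarrow> real"
  assumes add: "\<And>x y. p (x + y) \<le> p x + p y"
    and scale: "\<And>c x. p (c *\<^sub>C x) \<le> cmod c * p x"
  obtains f where "complex_linear f" "\<And>x. cmod (f x) \<le> p x" "f x0 = of_real (p x0)"
proof -
  have "sublinear p"
    unfolding sublinear_def using add scale
    by (metis scaleR_scaleC norm_of_real abs_of_nonneg)
  then obtain u where u: "linear u" "u \<le> p" "u x0 = p x0"
    using Hahn_Banach_real by blast
  \<comment> \<open>The imaginary part is forced by \<open>f (i x) = i f x\<close>.\<close>
  define f where "f x = Complex (u x) (- u (\<i> *\<^sub>C x))" for x
  have fadd: "f (x + y) = f x + f y" for x y
    by (simp add: f_def complex_eq_iff scaleC_add_right linear_add[OF u(1)])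
  have freal: "f (of_real r *\<^sub>C x) = of_real r * f x" for r x
  proof -
    have "\<i> *\<^sub>C (of_real r *\<^sub>C x) = r *\<^sub>R (\<i> *\<^sub>C x)"
      by (simp add: scaleR_scaleC scaleC_scaleC mult.commute)
    then show ?thesis
      by (simp add: f_def complex_eq_iff linear_scale[OF u(1)] scaleR_scaleC[symmetric])
  qed
  have fi: "f (\<i> *\<^sub>C x) = \<i> * f x" for x
    by (simp add: f_def complex_eq_iff scaleC_scaleC scaleC_minus_one linear_neg[OF u(1)])
  have fscale: "f (c *\<^sub>C x) = c * f x" for c x
  proof -
    have "f (c *\<^sub>C x) = f (of_real (Re c) *\<^sub>C x + \<i> *\<^sub>C (of_real (Im c) *\<^sub>C x))"
      by (metis complex_eq scaleC_add_left scaleC_scaleC)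
    also have "\<dots> = (of_real (Re c) + \<i> * of_real (Im c)) * f x"
      by (simp add: fadd fi freal algebra_simps)
    finally show ?thesis by (metis complex_eq)
  qed
  have bound: "cmod (f x) \<le> p x" for x
  proof -
    \<comment> \<open>Rotate \<open>x\<close> so that the value of \<open>f\<close> becomes real.\<close>
    obtain c where c: "cmod c = 1" "c * f x = of_real (cmod (f x))"
    proof (cases "f x = 0")
      case False
      then show ?thesis
        using complex_norm_square[of "f x"]
        by (intro that[of "cnj (f x) / of_real (cmod (f x))"])
          (auto simp: norm_divide field_simps power2_eq_square)
    qed (use that[of 1] in simp)
    have "cmod (f x) = Re (f (c *\<^sub>C x))" using c(2) by (simp add: fscale)
    also have "\<dots> = u (c *\<^sub>C x)" by (simp add: f_def)
    also have "\<dots> \<le> p (c *\<^sub>C x)" using u(2) by (simp add: le_fun_def)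
    also have "\<dots> \<le> p x" using scale[of c x] c(1) by simp
    finally show ?thesis .
  qed
  have "f x0 = of_real (p x0)"
  proof -
    have "Re (f x0) = p x0" by (simp add: f_def u(3))
    moreover have "(Re (f x0))\<^sup>2 + (Im (f x0))\<^sup>2 = (cmod (f x0))\<^sup>2"
      by (simp add: cmod_power2)
    moreover have "(cmod (f x0))\<^sup>2 \<le> (p x0)\<^sup>2"
      using bound by (intro power_mono) auto
    ultimately show ?thesis by (simp add: complex_eq_iff) (metis add_le_same_cancel1
      power2_less_eq_zero_iff)
  qed
  with fadd fscale bound show ?thesis by (intro that[of f]) (auto simp: complex_linear_def)
qed

section \<open>Modules of functionals and derivations into their duals\<close>

inductive_set cspan :: "'a::complex_banach_algebra set \<Rightarrow> 'a set" for G where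
  cspan_base: "g \<in> G \<Longrightarrow> g \<in> cspan G"
| cspan_add: "x \<in> cspan G \<Longrightarrow> y \<in> cspan G \<Longrightarrow> x + y \<in> cspan G"
| cspan_scale: "x \<in> cspan G \<Longrightarrow> c *\<^sub>C x \<in> cspan G"

text \<open>The functionals on the complex span \<open>J\<close> of \<open>G\<close> that are bounded on \<open>G\<close>, normed by their supremum
  over \<open>G\<close>: the dual of \<open>J\<close> for the norm whose unit ball is generated by \<open>G\<close>.  That norm may be much
  finer than the norm of the algebra.  The actions are the adjoints of \<open>L a\<close> and \<open>R a\<close>; they are
  parameters because one-sided actions, with the other side zero, are needed as well.  The
  elements are functions on the algebra, as required of the coefficient modules in
  \<^const>\<open>amenable\<close>.\<close>

definition functional_module ::
  "'a::complex_banach_algebra set \<Rightarrow> ('a \<Rightarrow> 'a \<Rightarrow> 'a) \<Rightarrow> ('a \<Rightarrow> 'a \<Rightarrow> 'a) \<Rightarrow> ('a, 'a \<Rightarrow> complex) bimod"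
  where
  "functional_module G L R = \<lparr>
     bm_carrier = {f \<in> extensional (cspan G).
       (\<forall>x\<in>cspan G. \<forall>y\<in>cspan G. f (x + y) = f x + f y) \<and>
       (\<forall>c. \<forall>x\<in>cspan G. f (c *\<^sub>C x) = c * f x) \<and>
       (\<exists>K. \<forall>g\<in>G. cmod (f g) \<le> K)},
     bm_zero = (\<lambda>x\<in>cspan G. 0),
     bm_add = (\<lambda>f h. \<lambda>x\<in>cspan G. f x + h x),
     bm_scale = (\<lambda>c f. \<lambda>x\<in>cspan G. c * f x),
     bm_norm = (\<lambda>f. SUP g\<in>G. cmod (f g)),
     bm_lact = (\<lambda>a f. \<lambda>x\<in>cspan G. f (R a x)),
     bm_ract = (\<lambda>f a. \<lambda>x\<in>cspan G. f (L a x))\<rparr>"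

text \<open>The conditions under which the above is a Banach bimodule.  The two hull conditions say that
  \<open>L a g\<close> and \<open>R a g\<close> lie in a multiple, of order \<open>norm a\<close>, of the absolutely convex hull of \<open>G\<close>;
  combinations of two elements of \<open>G\<close> suffice in the applications.\<close>

locale acting_pair =
  fixes G :: "'a::complex_banach_algebra set" and L R :: "'a \<Rightarrow> 'a \<Rightarrow> 'a"
  assumes G_nonempty: "G \<noteq> {}"
    and L_add: "L a (x + y) = L a x + L a y" and R_add: "R a (x + y) = R a x + R a y"
    and L_scale: "L a (c *\<^sub>C x) = c *\<^sub>C L a x" and R_scale: "R a (c *\<^sub>C x) = c *\<^sub>C R a x"
    and L_add_left: "L (a + b) x = L a x + L b x" and R_add_left: "R (a + b) x = R a x + R b x"
    and L_scale_left: "L (c *\<^sub>C a) x = c *\<^sub>C L a x" and R_scale_left: "R (c *\<^sub>C a) x = c *\<^sub>C R a x"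
    and L_mult: "L (a * b) x = L a (L b x)" and R_mult: "R (a * b) x = R b (R a x)"
    and L_R: "L a (R b x) = R b (L a x)"
    and L_hull: "\<exists>K. \<forall>a. \<forall>g\<in>G. \<exists>c d. \<exists>g'\<in>G. \<exists>h\<in>G.
      L a g = c *\<^sub>C g' + d *\<^sub>C h \<and> cmod c + cmod d \<le> K * norm a"
    and R_hull: "\<exists>K. \<forall>a. \<forall>g\<in>G. \<exists>c d. \<exists>g'\<in>G. \<exists>h\<in>G.
      R a g = c *\<^sub>C g' + d *\<^sub>C h \<and> cmod c + cmod d \<le> K * norm a"
begin

abbreviation "J \<equiv> cspan G"
abbreviation "Z \<equiv> functional_module G L R"
abbreviation "CZ \<equiv> bm_carrier Z"

lemma zero_mem_J: "0 \<in> J"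
  using G_nonempty cspan_base cspan_scale[of _ G 0] by fastforce

lemma carrierI:
  assumes "f \<in> extensional J" "\<And>x y. x \<in> J \<Longrightarrow> y \<in> J \<Longrightarrow> f (x + y) = f x + f y"
    "\<And>c x. x \<in> J \<Longrightarrow> f (c *\<^sub>C x) = c * f x" "\<And>g. g \<in> G \<Longrightarrow> cmod (f g) \<le> K"
  shows "f \<in> CZ"
  using assms unfolding functional_module_def by (simp, blast)

lemma carrier_ext: "f \<in> CZ \<Longrightarrow> f \<in> extensional J"
  and carrier_add: "f \<in> CZ \<Longrightarrow> x \<in> J \<Longrightarrow> y \<in> J \<Longrightarrow> f (x + y) = f x + f y"
  and carrier_scale: "f \<in> CZ \<Longrightarrow> x \<in> J \<Longrightarrow> f (c *\<^sub>C x) = c * f x"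
  by (auto simp: functional_module_def)

lemma norm_upper: assumes "f \<in> CZ" "g \<in> G" shows "cmod (f g) \<le> bm_norm Z f"
proof -
  from assms have "bdd_above ((\<lambda>g. cmod (f g)) ` G)"
    by (force simp: functional_module_def intro: bdd_aboveI2)
  then show ?thesis
    unfolding functional_module_def using cSUP_upper[OF assms(2)] by simp
qed

lemma norm_least: assumes "\<And>g. g \<in> G \<Longrightarrow> cmod (f g) \<le> K" shows "bm_norm Z f \<le> K"
  using assms G_nonempty by (simp add: functional_module_def cSUP_least)

lemma norm_ge_0: assumes "f \<in> CZ" shows "0 \<le> bm_norm Z f"
proof -
  obtain g where "g \<in> G" using G_nonempty by blast
  from norm_upper[OF assms this] show ?thesis by (meson norm_ge_zero order_trans)
qed

lemma carrier_vanish: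
  assumes f: "f \<in> CZ" and "\<And>g. g \<in> G \<Longrightarrow> f g = 0" and "x \<in> J"
  shows "f x = 0"
  using assms(3)
  by induction (use assms(2) carrier_add[OF f] carrier_scale[OF f] in auto)

lemma hull_mem: "x = c *\<^sub>C g + d *\<^sub>C h \<Longrightarrow> g \<in> G \<Longrightarrow> h \<in> G \<Longrightarrow> x \<in> J"
  by (auto intro: cspan.intros)

lemma L_mem_J: "x \<in> J \<Longrightarrow> L a x \<in> J"
proof (induction rule: cspan.induct)
  case (cspan_base g)
  then show ?case using L_hull hull_mem by metis
qed (auto simp: L_add L_scale intro: cspan.intros)

lemma R_mem_J: "x \<in> J \<Longrightarrow> R a x \<in> J"
proof (induction rule: cspan.induct)
  case (cspan_base g)
  then show ?case using R_hull hull_mem by metis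
qed (auto simp: R_add R_scale intro: cspan.intros)

lemma hull_bound:
  assumes f: "f \<in> CZ" and "x = c *\<^sub>C g + d *\<^sub>C h" "g \<in> G" "h \<in> G" "cmod c + cmod d \<le> K"
  shows "cmod (f x) \<le> K * bm_norm Z f"
proof -
  have "f x = c * f g + d * f h"
    using assms by (simp add: carrier_add carrier_scale cspan.intros)
  then have "cmod (f x) \<le> cmod c * cmod (f g) + cmod d * cmod (f h)"
    by (metis norm_mult norm_triangle_ineq)
  also have "\<dots> \<le> cmod c * bm_norm Z f + cmod d * bm_norm Z f"
    using assms by (intro add_mono mult_left_mono norm_upper) auto
  also have "\<dots> = (cmod c + cmod d) * bm_norm Z f" by (simp add: algebra_simps)
  also have "\<dots> \<le> K * bm_norm Z f" using assms norm_ge_0 by (intro mult_right_mono) auto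
  finally show ?thesis .
qed

lemma L_bound:
  obtains K where "\<And>a f g. f \<in> CZ \<Longrightarrow> g \<in> G \<Longrightarrow> cmod (f (L a g)) \<le> K * norm a * bm_norm Z f"
  using L_hull hull_bound by metis

lemma R_bound:
  obtains K where "\<And>a f g. f \<in> CZ \<Longrightarrow> g \<in> G \<Longrightarrow> cmod (f (R a g)) \<le> K * norm a * bm_norm Z f"
  using R_hull hull_bound by metis

lemma ops:
  "bm_zero Z = (\<lambda>x\<in>J. 0)" "bm_add Z f h = (\<lambda>x\<in>J. f x + h x)"
  "bm_scale Z c f = (\<lambda>x\<in>J. c * f x)" "bm_lact Z a f = (\<lambda>x\<in>J. f (R a x))"
  "bm_ract Z f a = (\<lambda>x\<in>J. f (L a x))" "bm_minus Z f h = (\<lambda>x\<in>J. f x - h x)"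
  by (auto simp: functional_module_def bm_minus_def)

lemma zero_mem: "(\<lambda>x\<in>J. 0) \<in> CZ"
  by (rule carrierI[where K = 0]) (auto intro: cspan.intros)

lemma add_mem: assumes "f \<in> CZ" "h \<in> CZ" shows "(\<lambda>x\<in>J. f x + h x) \<in> CZ"
proof (rule carrierI)
  fix g assume "g \<in> G"
  then show "cmod ((\<lambda>x\<in>J. f x + h x) g) \<le> bm_norm Z f + bm_norm Z h"
    using norm_upper assms by (auto simp: cspan_base intro!: norm_triangle_le add_mono)
qed (use assms in \<open>auto simp: carrier_add carrier_scale algebra_simps intro: cspan.intros\<close>)

lemma scale_mem: assumes "f \<in> CZ" shows "(\<lambda>x\<in>J. c * f x) \<in> CZ"
proof (rule carrierI)
  fix g assume "g \<in> G"
  then show "cmod ((\<lambda>x\<in>J. c * f x) g) \<le> cmod c * bm_norm Z f"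
    using norm_upper assms by (auto simp: cspan_base norm_mult intro!: mult_left_mono)
qed (use assms in \<open>auto simp: carrier_add carrier_scale algebra_simps intro: cspan.intros\<close>)

lemma L_dual_mem: assumes "f \<in> CZ" shows "(\<lambda>x\<in>J. f (L a x)) \<in> CZ"
proof -
  obtain K where K: "\<And>a f g. f \<in> CZ \<Longrightarrow> g \<in> G \<Longrightarrow> cmod (f (L a g)) \<le> K * norm a * bm_norm Z f"
    using L_bound by blast
  show ?thesis
    by (rule carrierI[where K = "K * norm a * bm_norm Z f"])
      (use assms K in \<open>auto simp: L_mem_J L_add L_scale carrier_add carrier_scale cspan.intros\<close>)
qed

lemma R_dual_mem: assumes "f \<in> CZ" shows "(\<lambda>x\<in>J. f (R a x)) \<in> CZ"
proof -
  obtain K where K: "\<And>a f g. f \<in> CZ \<Longrightarrow> g \<in> G \<Longrightarrow> cmod (f (R a g)) \<le> K * norm a * bm_norm Z f"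
    using R_bound by blast
  show ?thesis
    by (rule carrierI[where K = "K * norm a * bm_norm Z f"])
      (use assms K in \<open>auto simp: R_mem_J R_add R_scale carrier_add carrier_scale cspan.intros\<close>)
qed

text \<open>A Cauchy sequence converges uniformly on \<open>G\<close>, hence pointwise on the span \<open>J\<close>; the pointwise limit
  is the limit in norm.\<close>

lemma functional_module_complete:
  assumes s: "\<And>n. s n \<in> CZ"
    and Cauchy: "\<And>e. e > 0 \<Longrightarrow> \<exists>N. \<forall>m\<ge>N. \<forall>n\<ge>N. bm_norm Z (bm_minus Z (s m) (s n)) < e"
  shows "\<exists>l\<in>CZ. (\<lambda>n. bm_norm Z (bm_minus Z (s n) l)) \<longlonglongrightarrow> 0"
proof -
  have diff_mem: "(\<lambda>x\<in>J. f x - h x) \<in> CZ" if "f \<in> CZ" "h \<in> CZ" for f h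
  proof -
    have "(\<lambda>x\<in>J. f x + (\<lambda>x\<in>J. (- 1) * h x) x) \<in> CZ" using that by (intro add_mem scale_mem)
    also have "(\<lambda>x\<in>J. f x + (\<lambda>x\<in>J. (- 1) * h x) x) = (\<lambda>x\<in>J. f x - h x)" by auto
    finally show ?thesis .
  qed
  have near: "cmod (s m g - s n g) \<le> bm_norm Z (bm_minus Z (s m) (s n))" if "g \<in> G" for m n g
    using norm_upper[OF diff_mem[OF s s] that, of m n] that by (simp add: ops cspan_base)
  have conv: "convergent (\<lambda>n. s n x)" if "x \<in> J" for x
    using that
  proof induction
    case (cspan_base g)
    have "Cauchy (\<lambda>n. s n g)"
      unfolding Cauchy_def dist_norm using Cauchy near[OF cspan_base] by (meson le_less_trans)
    then show ?case by (rule Cauchy_convergent)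
  next
    case (cspan_add x y)
    then show ?case by (simp add: carrier_add[OF s] convergent_add)
  next
    case (cspan_scale x c)
    then show ?case by (auto simp: carrier_scale[OF s] convergent_def intro: tendsto_mult_left)
  qed
  define l where "l = (\<lambda>x\<in>J. lim (\<lambda>n. s n x))"
  have lim: "(\<lambda>n. s n x) \<longlonglongrightarrow> l x" if "x \<in> J" for x
    using conv[OF that] that by (simp add: l_def convergent_LIMSEQ_iff)
  have close: "\<exists>N. \<forall>n\<ge>N. \<forall>g\<in>G. cmod (s n g - l g) \<le> e" if "e > 0" for e
  proof -
    obtain N where N: "\<forall>m\<ge>N. \<forall>n\<ge>N. bm_norm Z (bm_minus Z (s m) (s n)) < e"
      using Cauchy[OF \<open>e > 0\<close>] by blast
    have "cmod (s n g - l g) \<le> e" if "n \<ge> N" "g \<in> G" for n g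
    proof (rule LIMSEQ_le_const2)
      show "(\<lambda>m. cmod (s n g - s m g)) \<longlonglongrightarrow> cmod (s n g - l g)"
        using that by (intro tendsto_intros lim cspan_base)
      show "\<exists>M. \<forall>m\<ge>M. cmod (s n g - s m g) \<le> e"
        using N near that by (meson le_less_trans less_imp_le)
    qed
    then show ?thesis by blast
  qed
  obtain N where N: "\<And>g. g \<in> G \<Longrightarrow> cmod (s N g - l g) \<le> 1" using close[of 1] by auto
  have l: "l \<in> CZ"
  proof (rule carrierI)
    show "l \<in> extensional J" by (simp add: l_def)
    show "l (x + y) = l x + l y" if "x \<in> J" "y \<in> J" for x y
      using LIMSEQ_unique[OF lim[OF cspan_add[OF that]]] tendsto_add[OF lim lim] that
      by (simp add: carrier_add[OF s])
    show "l (c *\<^sub>C x) = c * l x" if "x \<in> J" for c x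
      using LIMSEQ_unique[OF lim[OF cspan_scale[OF that]]] tendsto_mult_left[OF lim] that
      by (simp add: carrier_scale[OF s])
    show "cmod (l g) \<le> bm_norm Z (s N) + 1" if "g \<in> G" for g
      using norm_upper[OF s that, of N] N[OF that] norm_triangle_ineq3[of "s N g" "l g"]
      by linarith
  qed
  have "(\<lambda>n. bm_norm Z (bm_minus Z (s n) l)) \<longlonglongrightarrow> 0"
  proof (rule LIMSEQ_I)
    fix e :: real assume "e > 0"
    then obtain N where N: "\<And>n g. n \<ge> N \<Longrightarrow> g \<in> G \<Longrightarrow> cmod (s n g - l g) \<le> e / 2"
      using close[of "e / 2"] by auto
    have "norm (bm_norm Z (bm_minus Z (s n) l) - 0) < e" if "n \<ge> N" for n
    proof -
      have "bm_norm Z (bm_minus Z (s n) l) \<le> e / 2"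
        by (rule norm_least) (use N[OF that] in \<open>simp add: ops cspan_base\<close>)
      with norm_ge_0[OF diff_mem[OF s l], of n] \<open>e > 0\<close> show ?thesis
        by (simp add: ops)
    qed
    then show "\<exists>N. \<forall>n\<ge>N. norm (bm_norm Z (bm_minus Z (s n) l) - 0) < e" by blast
  qed
  with l show ?thesis by blast
qed

lemma norm_scale_eq:
  assumes "f \<in> CZ" shows "bm_norm Z (bm_scale Z c f) = cmod c * bm_norm Z f"
proof (rule antisym)
  have le: "bm_norm Z (bm_scale Z c f) \<le> cmod c * bm_norm Z f" if "f \<in> CZ" for c f
    by (rule norm_least)
      (use norm_upper[OF that] in \<open>auto simp: ops cspan_base norm_mult intro: mult_left_mono\<close>)
  show "bm_norm Z (bm_scale Z c f) \<le> cmod c * bm_norm Z f" using le[OF assms] .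
  show "cmod c * bm_norm Z f \<le> bm_norm Z (bm_scale Z c f)"
  proof (cases "c = 0")
    case True
    then show ?thesis using norm_ge_0[OF zero_mem] by (simp add: ops)
  next
    case False
    have "bm_norm Z (bm_scale Z (inverse c) (bm_scale Z c f))
        \<le> cmod (inverse c) * bm_norm Z (bm_scale Z c f)"
      by (rule le) (simp add: ops scale_mem assms)
    moreover have "bm_scale Z (inverse c) (bm_scale Z c f) = f"
      using False carrier_ext[OF assms] by (auto simp: ops fun_eq_iff extensional_def)
    ultimately show ?thesis using False by (simp add: norm_inverse norm_divide field_simps)
  qed
qed

theorem banach_bimodule_functional_module: "banach_bimodule UNIV Z"
proof
  show "\<exists>K. \<forall>a\<in>UNIV. \<forall>f\<in>CZ. bm_norm Z (bm_lact Z a f) \<le> K * norm a * bm_norm Z f \<and>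
      bm_norm Z (bm_ract Z f a) \<le> K * norm a * bm_norm Z f"
  proof -
    obtain K where K: "\<And>a f g. f \<in> CZ \<Longrightarrow> g \<in> G \<Longrightarrow> cmod (f (L a g)) \<le> K * norm a * bm_norm Z f"
      using L_bound by blast
    obtain K' where K': "\<And>a f g. f \<in> CZ \<Longrightarrow> g \<in> G \<Longrightarrow> cmod (f (R a g)) \<le> K' * norm a * bm_norm Z f"
      using R_bound by blast
    have le: "k * norm a * bm_norm Z f \<le> max K K' * norm a * bm_norm Z f"
      if "f \<in> CZ" "k \<le> max K K'" for k f and a :: 'a
      using that norm_ge_0 by (intro mult_right_mono) auto
    have "bm_norm Z (bm_lact Z a f) \<le> max K K' * norm a * bm_norm Z f" if "f \<in> CZ" for a f
      by (rule norm_least)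
        (use K' le[of f K'] that in \<open>fastforce simp: ops cspan_base intro: order_trans\<close>)
    moreover have "bm_norm Z (bm_ract Z f a) \<le> max K K' * norm a * bm_norm Z f"
      if "f \<in> CZ" for a f
      by (rule norm_least)
        (use K le[of f K] that in \<open>fastforce simp: ops cspan_base intro: order_trans\<close>)
    ultimately show ?thesis by blast
  qed
  show "bm_norm Z f = 0 \<longleftrightarrow> f = bm_zero Z" if f: "f \<in> CZ" for f
  proof
    assume 0: "bm_norm Z f = 0"
    have "f g = 0" if "g \<in> G" for g using norm_upper[OF f that] 0 by simp
    then have "f x = 0" if "x \<in> J" for x using carrier_vanish[OF f] that by blast
    with carrier_ext[OF f] show "f = bm_zero Z" by (auto simp: ops fun_eq_iff extensional_def)
  next
    assume "f = bm_zero Z"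
    then show "bm_norm Z f = 0"
      using norm_least[of f 0] norm_ge_0[OF f] by (auto simp: ops cspan_base)
  qed
  show "bm_norm Z (bm_add Z f h) \<le> bm_norm Z f + bm_norm Z h" if "f \<in> CZ" "h \<in> CZ" for f h
    by (rule norm_least)
      (use norm_upper that in \<open>auto simp: ops cspan_base intro!: norm_triangle_le add_mono\<close>)
  show "\<exists>l\<in>CZ. (\<lambda>n. bm_norm Z (bm_minus Z (s n) l)) \<longlonglongrightarrow> 0"
    if "\<And>n. s n \<in> CZ"
      "\<And>e. e > 0 \<Longrightarrow> \<exists>N. \<forall>m\<ge>N. \<forall>n\<ge>N. bm_norm Z (bm_minus Z (s m) (s n)) < e" for s
    using functional_module_complete that by blast
  show "bm_add Z (bm_zero Z) f = f" "bm_scale Z 1 f = f" if "f \<in> CZ" for f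
    using carrier_ext[OF that] by (auto simp: ops fun_eq_iff extensional_def)
qed (auto simp: ops zero_mem add_mem scale_mem L_dual_mem R_dual_mem
  norm_ge_0 norm_scale_eq[unfolded ops] L_mem_J R_mem_J carrier_add carrier_scale fun_eq_iff
  L_add_left R_add_left L_scale_left R_scale_left L_mult R_mult L_R algebra_simps)

text \<open>A map \<open>d\<close> into a multiple of \<open>G\<close> that satisfies Leibniz' rule induces, by evaluation, a derivation
  into the dual of the functional module.  The functional \<open>\<Theta>\<close> that implements this derivation plays
  the part of an element of the bidual of \<open>J\<close> with \<open>d a = a \<Theta> - \<Theta> a\<close>.\<close>

theorem amenable_implements:
  assumes amenable: "amenable (UNIV :: 'a set)"
    and d_add: "\<And>a b. d (a + b) = d a + d b" and d_scale: "\<And>c a. d (c *\<^sub>C a) = c *\<^sub>C d a"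
    and d_mult: "\<And>a b. d (a * b) = L a (d b) + R b (d a)"
    and d_bound: "\<And>a. \<exists>c. \<exists>g\<in>G. d a = c *\<^sub>C g \<and> cmod c \<le> K * norm a"
  obtains \<Theta> where "\<Theta> \<in> bm_carrier (bm_dual Z)"
    "\<And>a f. f \<in> CZ \<Longrightarrow> f (d a) = \<Theta> (\<lambda>x\<in>J. f (L a x)) - \<Theta> (\<lambda>x\<in>J. f (R a x))"
proof -
  define D where "D a = (\<lambda>f\<in>CZ. f (d a))" for a
  have d_mem: "d a \<in> J" for a using d_bound[of a] by (metis cspan_base cspan_scale)
  have d_le: "cmod (f (d a)) \<le> K * norm a * bm_norm Z f" if f: "f \<in> CZ" for f a
  proof -
    obtain c g where "g \<in> G" "d a = c *\<^sub>C g" "cmod c \<le> K * norm a" using d_bound by blast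
    then show ?thesis using hull_bound[OF f, of "d a" c g 0 g "K * norm a"] by simp
  qed
  have D_mem: "D a \<in> bm_carrier (bm_dual Z)" for a
    using d_le by (auto simp: bm_dual_def D_def ops add_mem scale_mem d_mem
      intro!: exI[of _ "K * norm a"])
  have "bm_norm (bm_dual Z) (D a) \<le> \<bar>K\<bar> * norm a" for a
  proof -
    have "(SUP f\<in>{f \<in> CZ. bm_norm Z f \<le> 1}. cmod (D a f)) \<le> \<bar>K\<bar> * norm a"
    proof (rule cSUP_least)
      have "bm_norm Z (\<lambda>x\<in>J. 0) \<le> 0" by (rule norm_least) (simp add: cspan_base)
      then show "{f \<in> CZ. bm_norm Z f \<le> 1} \<noteq> {}" using zero_mem by fastforce
    next
      fix f assume "f \<in> {f \<in> CZ. bm_norm Z f \<le> 1}"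
      then have f: "f \<in> CZ" "bm_norm Z f \<le> 1" by auto
      have "cmod (f (d a)) \<le> K * norm a * bm_norm Z f" by (rule d_le[OF f(1)])
      also have "\<dots> \<le> (\<bar>K\<bar> * norm a) * 1"
        using f norm_ge_0 by (intro mult_mono) (auto intro: mult_right_mono)
      finally show "cmod (D a f) \<le> \<bar>K\<bar> * norm a" using f by (simp add: D_def)
    qed
    then show ?thesis by (simp add: bm_dual_def)
  qed
  moreover have "D (a * b) = bm_add (bm_dual Z) (bm_lact (bm_dual Z) a (D b))
      (bm_ract (bm_dual Z) (D a) b)" for a b
    by (auto simp: bm_dual_def D_def fun_eq_iff ops L_dual_mem R_dual_mem d_mem d_mult
      carrier_add L_mem_J R_mem_J)
  moreover have "D (a + b) = bm_add (bm_dual Z) (D a) (D b)"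
    "D (c *\<^sub>C a) = bm_scale (bm_dual Z) c (D a)" for a b c
    by (auto simp: bm_dual_def D_def fun_eq_iff d_add d_scale carrier_add carrier_scale d_mem)
  ultimately have "dual_derivation UNIV Z D"
    unfolding dual_derivation_def Let_def using D_mem by blast
  then have "inner_dual_derivation UNIV Z D"
    using amenable banach_bimodule_functional_module unfolding amenable_def by blast
  then obtain \<Theta> where \<Theta>: "\<Theta> \<in> bm_carrier (bm_dual Z)"
    "\<And>a. D a = bm_minus (bm_dual Z) (bm_lact (bm_dual Z) a \<Theta>) (bm_ract (bm_dual Z) \<Theta> a)"
    unfolding inner_dual_derivation_def Let_def by blast
  have "f (d a) = \<Theta> (\<lambda>x\<in>J. f (L a x)) - \<Theta> (\<lambda>x\<in>J. f (R a x))" if "f \<in> CZ" for a f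
    using fun_cong[OF \<Theta>(2)[of a], of f] that by (simp add: D_def bm_dual_def bm_minus_def ops)
  with \<Theta>(1) that show ?thesis by blast
qed

end

section \<open>Bounded functionals and weak approximate units\<close>

definition bounded_cfunctional :: "('a::complex_banach_algebra \<Rightarrow> complex) \<Rightarrow> bool" where
  "bounded_cfunctional f \<longleftrightarrow> complex_linear f \<and> (\<exists>K. \<forall>x. cmod (f x) \<le> K * norm x)"

lemma bcf_add: "bounded_cfunctional f \<Longrightarrow> f (x + y) = f x + f y"
  and bcf_scale: "bounded_cfunctional f \<Longrightarrow> f (c *\<^sub>C x) = c * f x"
  by (auto simp: bounded_cfunctional_def complex_linear_def)

lemma bcf_zero: "bounded_cfunctional f \<Longrightarrow> f 0 = 0"
  using bcf_scale[of f 0 0] by simp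

lemma bcf_minus: "bounded_cfunctional f \<Longrightarrow> f (- x) = - f x"
  using bcf_scale[of f "- 1" x] by (simp add: scaleC_minus_one)

lemma bcf_bound: assumes "bounded_cfunctional f" obtains K where "K \<ge> 0" "\<And>x. cmod (f x) \<le> K * norm x"
proof -
  obtain K where "\<And>x. cmod (f x) \<le> K * norm x" using assms by (auto simp: bounded_cfunctional_def)
  then have "cmod (f x) \<le> max K 0 * norm x" for x
    by (meson max.cobounded1 mult_right_mono norm_ge_zero order_trans)
  then show ?thesis using that[of "max K 0"] by simp
qed

lemma bcfI:
  assumes "\<And>x y. f (x + y) = f x + f y" "\<And>c x. f (c *\<^sub>C x) = c * f x"
    "\<And>x. cmod (f x) \<le> K * norm x"
  shows "bounded_cfunctional f"
  using assms unfolding bounded_cfunctional_def complex_linear_def by blast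

lemma bcf_compose:
  assumes f: "bounded_cfunctional f" and T: "bounded_clinear_op T" shows "bounded_cfunctional (\<lambda>x. f (T x))"
proof -
  obtain K where K: "K \<ge> 0" "\<And>x. cmod (f x) \<le> K * norm x" using bcf_bound[OF f] by blast
  from T have bl: "bounded_linear T" and sc: "\<And>c x. T (c *\<^sub>C x) = c *\<^sub>C T x"
    by (auto simp: bounded_clinear_op_def)
  obtain B where B: "\<And>x. norm (T x) \<le> norm x * B" using bounded_linear.bounded[OF bl] by blast
  have "cmod (f (T x)) \<le> (K * B) * norm x" for x
    using order_trans[OF K(2) mult_left_mono[OF B K(1)]] by (simp add: mult_ac)
  then show ?thesis
    by (intro bcfI) (auto simp: bcf_add[OF f] bcf_scale[OF f] sc
      linear_add[OF bounded_linear.linear[OF bl]])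
qed

lemma bcf_separates:
  fixes x :: "'a::complex_banach_algebra"
  assumes "\<And>f. bounded_cfunctional f \<Longrightarrow> f x = 0" shows "x = 0"
proof -
  obtain f where f: "complex_linear f" "\<And>y. cmod (f y) \<le> norm y" "f x = of_real (norm x)"
    using Hahn_Banach_complex[of norm x] norm_triangle_ineq by (auto simp: norm_scaleC)
  then have "bounded_cfunctional f" unfolding bounded_cfunctional_def by (metis mult_1)
  with assms f(3) show ?thesis by fastforce
qed

lemma clinear_op_mult_left: "bounded_clinear_op (\<lambda>x. a * x)"
  and clinear_op_mult_right: "bounded_clinear_op (\<lambda>x. x * a)"
  by (auto simp: bounded_clinear_op_def bounded_linear_mult_right bounded_linear_mult_left
    mult_scaleC_left mult_scaleC_right)

lemma clinear_op_compose:
  "bounded_clinear_op S \<Longrightarrow> bounded_clinear_op T \<Longrightarrow> bounded_clinear_op (\<lambda>x. S (T x))"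
  by (auto simp: bounded_clinear_op_def bounded_linear_compose)

text \<open>For \<open>t = 0\<close> the convention \<open>inverse 0 = 0\<close> gives \<open>y = 0\<close>.  That \<open>y\<close> is a multiple of \<open>x\<close> lets one
  stay inside a subspace.\<close>

lemma scaleC_normalize:
  fixes x :: "'a::complex_banach_algebra"
  assumes "norm x \<le> t"
  obtains y where "x = of_real t *\<^sub>C y" "norm y \<le> 1" "y = of_real (inverse t) *\<^sub>C x"
proof -
  define y where "y = of_real (inverse t) *\<^sub>C x"
  have "0 \<le> t" using assms norm_ge_zero order_trans by blast
  show ?thesis
  proof (cases "t = 0")
    case True
    then show ?thesis using assms that[of y] by (simp add: y_def)
  next
    case False
    then have "x = of_real t *\<^sub>C y" by (simp add: y_def scaleC_scaleC)
    moreover have "norm y \<le> 1"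
      using False \<open>0 \<le> t\<close> assms by (simp add: y_def norm_scaleC norm_inverse norm_divide field_simps)
    ultimately show ?thesis using that y_def by blast
  qed
qed

lemma cspan_ball: "cspan {x::'a::complex_banach_algebra. norm x \<le> 1} = UNIV"
proof -
  have "x \<in> cspan {x::'a. norm x \<le> 1}" for x :: 'a
  proof -
    obtain y where "x = of_real (norm x) *\<^sub>C y" "norm y \<le> 1"
      by (rule scaleC_normalize[of x "norm x"]) auto
    then show ?thesis by (metis (mono_tags) cspan_base cspan_scale mem_Collect_eq)
  qed
  then show ?thesis by blast
qed

lemma ball_hull:
  fixes x :: "'a::complex_banach_algebra"
  assumes "norm x \<le> t"
  shows "\<exists>c d. \<exists>g\<in>{x. norm x \<le> 1}. \<exists>h\<in>{x. norm x \<le> 1}.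
    x = c *\<^sub>C g + d *\<^sub>C h \<and> cmod c + cmod d \<le> t"
proof -
  have "0 \<le> t" using assms norm_ge_zero order_trans by blast
  obtain y where "x = of_real t *\<^sub>C y" "norm y \<le> 1" by (rule scaleC_normalize[OF assms])
  then show ?thesis using \<open>0 \<le> t\<close>
    by (intro exI[of _ "of_real t"] exI[of _ 0] bexI[of _ y] bexI[of _ 0]) auto
qed

lemma bcf_mem_ball_module:
  assumes f: "bounded_cfunctional f"
  shows "f \<in> bm_carrier (functional_module {x. norm x \<le> 1} L R)"
proof -
  obtain K where K: "K \<ge> 0" "\<And>x. cmod (f x) \<le> K * norm x" using bcf_bound[OF f] by blast
  have "cmod (f x) \<le> K" if "norm x \<le> 1" for x
    using order_trans[OF K(2) mult_left_mono[OF that K(1)]] by simp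
  then show ?thesis by (auto simp: functional_module_def cspan_ball bcf_add[OF f] bcf_scale[OF f])
qed

lemma dual_zero:
  assumes "\<Theta> \<in> bm_carrier (bm_dual (functional_module G L R))"
    and "acting_pair G L R"
  shows "\<Theta> (\<lambda>x\<in>cspan G. 0) = 0"
proof -
  interpret acting_pair G L R by fact
  have "\<Theta> (bm_scale Z 0 (\<lambda>x\<in>J. 0)) = 0 * \<Theta> (\<lambda>x\<in>J. 0)"
    using assms(1) zero_mem unfolding bm_dual_def by (simp del: mult_zero_left)
  then show ?thesis by (simp add: ops)
qed

text \<open>This is what remains of a bounded right approximate identity.  Give the dual of the algebra the
  one-sided action \<open>(f \<cdot> a) x = f (a x)\<close>, \<open>a \<cdot> f = 0\<close>.  The inclusion of the algebra in its bidual is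
  then a derivation, so some \<open>E\<close> in the bidual satisfies \<open>f a = E (f \<cdot> a)\<close>; if \<open>f \<cdot> a = 0\<close>, then
  \<open>f a = 0\<close>.\<close>

lemma amenable_weak_right_unit:
  fixes a :: "'a::complex_banach_algebra"
  assumes "amenable (UNIV :: 'a set)" and f: "bounded_cfunctional f" and van: "\<And>x. f (a * x) = 0"
  shows "f a = 0"
proof -
  let ?G = "{x::'a. norm x \<le> 1}"
  interpret acting_pair ?G "(*)" "\<lambda>a x. 0"
  proof
    have "norm (b * g) \<le> 1 * norm b" if "g \<in> ?G" for b g :: 'a
      using norm_mult_ineq[of b g] that mult_left_mono[of "norm g" 1 "norm b"] by simp
    then show "\<exists>K. \<forall>a. \<forall>g\<in>?G. \<exists>c d. \<exists>g'\<in>?G. \<exists>h\<in>?G.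
        a * g = c *\<^sub>C g' + d *\<^sub>C h \<and> cmod c + cmod d \<le> K * norm a"
      using ball_hull by blast
    show "\<exists>K. \<forall>a::'a. \<forall>g\<in>?G. \<exists>c d. \<exists>g'\<in>?G. \<exists>h\<in>?G.
        0 = c *\<^sub>C g' + d *\<^sub>C h \<and> cmod c + cmod d \<le> K * norm a"
      by (intro exI[of _ 0] allI ballI bexI[of _ 0]) auto
    show "?G \<noteq> {}" by (auto intro: exI[of _ 0])
  qed (auto simp: algebra_simps mult_scaleC_left mult_scaleC_right)
  obtain \<Theta> where \<Theta>: "\<Theta> \<in> bm_carrier (bm_dual Z)"
    "\<And>a f. f \<in> CZ \<Longrightarrow> f a = \<Theta> (\<lambda>x\<in>J. f (a * x)) - \<Theta> (\<lambda>x\<in>J. f 0)"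
  proof (rule amenable_implements[OF assms(1), of "\<lambda>x. x" 1])
    show "\<exists>c. \<exists>g\<in>?G. a = c *\<^sub>C g \<and> cmod c \<le> 1 * norm a" for a :: 'a
      by (rule scaleC_normalize[of a "norm a"]) (auto intro: exI[of _ "of_real (norm a)"])
  qed auto
  from \<Theta>(2)[OF bcf_mem_ball_module[OF f], of a] show ?thesis
    by (simp add: van bcf_zero[OF f] dual_zero[OF \<Theta>(1) acting_pair_axioms])
qed

lemma amenable_weak_left_unit:
  fixes a :: "'a::complex_banach_algebra"
  assumes "amenable (UNIV :: 'a set)" and f: "bounded_cfunctional f" and van: "\<And>x. f (x * a) = 0"
  shows "f a = 0"
proof -
  let ?G = "{x::'a. norm x \<le> 1}"
  interpret acting_pair ?G "\<lambda>a x. 0" "\<lambda>a x. x * a"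
  proof
    have "norm (g * b) \<le> 1 * norm b" if "g \<in> ?G" for b g :: 'a
      using norm_mult_ineq[of g b] that mult_right_mono[of "norm g" 1 "norm b"] by simp
    then show "\<exists>K. \<forall>a. \<forall>g\<in>?G. \<exists>c d. \<exists>g'\<in>?G. \<exists>h\<in>?G.
        g * a = c *\<^sub>C g' + d *\<^sub>C h \<and> cmod c + cmod d \<le> K * norm a"
      using ball_hull by blast
    show "\<exists>K. \<forall>a::'a. \<forall>g\<in>?G. \<exists>c d. \<exists>g'\<in>?G. \<exists>h\<in>?G.
        0 = c *\<^sub>C g' + d *\<^sub>C h \<and> cmod c + cmod d \<le> K * norm a"
      by (intro exI[of _ 0] allI ballI bexI[of _ 0]) auto
    show "?G \<noteq> {}" by (auto intro: exI[of _ 0])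
  qed (auto simp: algebra_simps mult_scaleC_left mult_scaleC_right)
  obtain \<Theta> where \<Theta>: "\<Theta> \<in> bm_carrier (bm_dual Z)"
    "\<And>a f. f \<in> CZ \<Longrightarrow> f a = \<Theta> (\<lambda>x\<in>J. f 0) - \<Theta> (\<lambda>x\<in>J. f (x * a))"
  proof (rule amenable_implements[OF assms(1), of "\<lambda>x. x" 1])
    show "\<exists>c. \<exists>g\<in>?G. a = c *\<^sub>C g \<and> cmod c \<le> 1 * norm a" for a :: 'a
      by (rule scaleC_normalize[of a "norm a"]) (auto intro: exI[of _ "of_real (norm a)"])
  qed auto
  from \<Theta>(2)[OF bcf_mem_ball_module[OF f], of a] show ?thesis
    by (simp add: van bcf_zero[OF f] dual_zero[OF \<Theta>(1) acting_pair_axioms])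
qed

section \<open>Absolutely convergent series of products\<close>

definition pair_sum :: "('a::complex_banach_algebra \<times> 'a) list \<Rightarrow> 'a" where
  "pair_sum ps = (\<Sum>(a, b)\<leftarrow>ps. a * b)"

definition pair_cost :: "('a::complex_banach_algebra \<times> 'a) list \<Rightarrow> real" where
  "pair_cost ps = (\<Sum>(a, b)\<leftarrow>ps. norm a * norm b)"

lemma pair_sum_simps [simp]: "pair_sum [] = 0" "pair_sum (p # ps) = fst p * snd p + pair_sum ps"
  "pair_sum (ps @ qs) = pair_sum ps + pair_sum qs"
  by (auto simp: pair_sum_def case_prod_unfold)

lemma pair_cost_simps [simp]: "pair_cost [] = 0" "pair_cost (p # ps) = norm (fst p) * norm (snd p) + pair_cost ps"
  "pair_cost (ps @ qs) = pair_cost ps + pair_cost qs"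
  by (auto simp: pair_cost_def case_prod_unfold)

lemma pair_cost_nonneg: "0 \<le> pair_cost ps"
  by (induction ps) auto

lemma pair_sum_scale: "pair_sum (map (\<lambda>(a, b). (c *\<^sub>C a, b)) ps) = c *\<^sub>C pair_sum ps"
  by (induction ps) (auto simp: scaleC_add_right mult_scaleC_left)

lemma pair_cost_scale: "pair_cost (map (\<lambda>(a, b). (c *\<^sub>C a, b)) ps) = cmod c * pair_cost ps"
  by (induction ps) (auto simp: norm_scaleC algebra_simps)

text \<open>For \<open>M \<ge> 0\<close> and \<open>X\<close> closed under scalars, this is the interpolation seminorm between the
  projective norm of a finite sum of products and \<open>M\<close> times the norm of the algebra.  The second
  term makes it finite on the whole algebra, so that the Hahn--Banach theorem applies to it.
  If it is at most \<open>K * norm y\<close> with \<open>K\<close> much smaller than \<open>M\<close>, then \<open>y\<close> is close to a finite sum of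
  products of controlled size.\<close>

definition gauge_norm :: "'a::complex_banach_algebra set \<Rightarrow> 'a set \<Rightarrow> real \<Rightarrow> 'a \<Rightarrow> real" where
  "gauge_norm X Y M y = (INF ps\<in>lists (X \<times> Y). pair_cost ps + M * norm (y - pair_sum ps))"

context
  fixes X Y :: "'a::complex_banach_algebra set" and M :: real
  assumes M: "M \<ge> 0" and X_scale: "\<And>c x. x \<in> X \<Longrightarrow> c *\<^sub>C x \<in> X"
begin

lemma gauge_norm_le:
  assumes "ps \<in> lists (X \<times> Y)" shows "gauge_norm X Y M y \<le> pair_cost ps + M * norm (y - pair_sum ps)"
  unfolding gauge_norm_def
proof (rule cINF_lower[OF _ assms])
  show "bdd_below ((\<lambda>ps. pair_cost ps + M * norm (y - pair_sum ps)) ` lists (X \<times> Y))"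
    by (intro bdd_belowI2[of _ 0] add_nonneg_nonneg mult_nonneg_nonneg pair_cost_nonneg norm_ge_zero M)
qed

lemma gauge_norm_greatest:
  assumes "\<And>ps. ps \<in> lists (X \<times> Y) \<Longrightarrow> m \<le> pair_cost ps + M * norm (y - pair_sum ps)"
  shows "m \<le> gauge_norm X Y M y"
  unfolding gauge_norm_def using assms by (intro cINF_greatest) auto

lemma gauge_norm_le_norm: "gauge_norm X Y M y \<le> M * norm y"
  using gauge_norm_le[of "[]" y] by simp

lemma gauge_norm_mult_le: "a \<in> X \<Longrightarrow> b \<in> Y \<Longrightarrow> gauge_norm X Y M (a * b) \<le> norm a * norm b"
  using gauge_norm_le[of "[(a, b)]" "a * b"] by simp

lemma gauge_norm_triangle: "gauge_norm X Y M (x + y) \<le> gauge_norm X Y M x + gauge_norm X Y M y"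
proof -
  let ?p = "gauge_norm X Y M"
  have "?p (x + y) \<le> (pair_cost ps + M * norm (x - pair_sum ps)) + (pair_cost qs + M * norm (y - pair_sum qs))"
    if "ps \<in> lists (X \<times> Y)" "qs \<in> lists (X \<times> Y)" for ps qs
  proof -
    have "?p (x + y) \<le> pair_cost (ps @ qs) + M * norm (x + y - pair_sum (ps @ qs))"
      using that by (intro gauge_norm_le) auto
    also have "M * norm (x + y - pair_sum (ps @ qs)) \<le> M * (norm (x - pair_sum ps) + norm (y - pair_sum qs))"
      using norm_triangle_ineq[of "x - pair_sum ps" "y - pair_sum qs"] M
      by (intro mult_left_mono) (simp_all add: algebra_simps)
    finally show ?thesis by (simp add: algebra_simps)
  qed
  then have "?p (x + y) - (pair_cost qs + M * norm (y - pair_sum qs)) \<le> ?p x"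
    if "qs \<in> lists (X \<times> Y)" for qs
    using that by (intro gauge_norm_greatest) (simp add: algebra_simps)
  then have "?p (x + y) - ?p x \<le> ?p y"
    by (intro gauge_norm_greatest) (simp add: algebra_simps)
  then show ?thesis by simp
qed

lemma gauge_norm_scale: "gauge_norm X Y M (c *\<^sub>C y) \<le> cmod c * gauge_norm X Y M y"
proof (cases "c = 0")
  case True
  then show ?thesis using gauge_norm_le_norm[of 0] by simp
next
  case False
  have "gauge_norm X Y M (c *\<^sub>C y) / cmod c \<le> gauge_norm X Y M y"
  proof (rule gauge_norm_greatest)
    fix ps assume ps: "ps \<in> lists (X \<times> Y)"
    let ?qs = "map (\<lambda>(a, b). (c *\<^sub>C a, b)) ps"
    have "gauge_norm X Y M (c *\<^sub>C y) \<le> pair_cost ?qs + M * norm (c *\<^sub>C y - pair_sum ?qs)"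
      using ps X_scale by (intro gauge_norm_le) (auto simp: lists_eq_set)
    also have "c *\<^sub>C y - pair_sum ?qs = c *\<^sub>C (y - pair_sum ps)"
      using scaleC_add_right[of c y "- pair_sum ps"] by (simp add: pair_sum_scale scaleC_minus_right)
    finally have "gauge_norm X Y M (c *\<^sub>C y) \<le> cmod c * (pair_cost ps + M * norm (y - pair_sum ps))"
      by (simp add: pair_cost_scale norm_scaleC algebra_simps)
    then show "gauge_norm X Y M (c *\<^sub>C y) / cmod c \<le> pair_cost ps + M * norm (y - pair_sum ps)"
      using False by (simp add: field_simps)
  qed
  then show ?thesis using False by (simp add: field_simps)
qed

end

text \<open>A series of finite sums of products is one absolutely convergent series of products: pad the
  lists with zeros and enumerate the resulting double sequence by \<^const>\<open>prod_decode\<close>.\<close>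

lemma suminf_pair_sum_in_proj_image:
  fixes PS :: "nat \<Rightarrow> ('a::complex_banach_algebra \<times> 'a) list"
  assumes PS: "\<And>n. PS n \<in> lists (X \<times> Y)" and zero: "0 \<in> X" "0 \<in> Y"
    and pair_cost: "summable (\<lambda>n. pair_cost (PS n))" and pair_sum: "(\<lambda>n. pair_sum (PS n)) sums y"
  shows "y \<in> proj_image X Y"
proof -
  define a where "a = (\<lambda>(n, k). if k < length (PS n) then fst (PS n ! k) else 0)"
  define b where "b = (\<lambda>(n, k). if k < length (PS n) then snd (PS n ! k) else 0)"
  have mem: "a p \<in> X" "b p \<in> Y" for p
  proof -
    have "PS n ! k \<in> X \<times> Y" if "k < length (PS n)" for n k
      using PS[of n] that by (auto simp: lists_eq_set)
    then show "a p \<in> X" "b p \<in> Y"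
      using zero by (auto simp: a_def b_def case_prod_unfold mem_Times_iff)
  qed
  have val_row: "((\<lambda>k. a (n, k) * b (n, k)) has_sum pair_sum (PS n)) UNIV" for n
  proof -
    have "((\<lambda>k. a (n, k) * b (n, k)) has_sum (\<Sum>k<length (PS n). a (n, k) * b (n, k)))
        {..<length (PS n)}"
      by (rule has_sum_finite) simp
    also have "(\<Sum>k<length (PS n). a (n, k) * b (n, k)) = pair_sum (PS n)"
      by (simp add: pair_sum_def sum_list_sum_nth atLeast0LessThan a_def b_def case_prod_unfold)
    finally show ?thesis
      by (rule has_sum_cong_neutral[THEN iffD1, rotated -1]) (auto simp: a_def)
  qed
  have cost_row: "((\<lambda>k. norm (a (n, k)) * norm (b (n, k))) has_sum pair_cost (PS n)) UNIV" for n
  proof -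
    have "((\<lambda>k. norm (a (n, k)) * norm (b (n, k))) has_sum
        (\<Sum>k<length (PS n). norm (a (n, k)) * norm (b (n, k)))) {..<length (PS n)}"
      by (rule has_sum_finite) simp
    also have "(\<Sum>k<length (PS n). norm (a (n, k)) * norm (b (n, k))) = pair_cost (PS n)"
      by (simp add: pair_cost_def sum_list_sum_nth atLeast0LessThan a_def b_def case_prod_unfold)
    finally show ?thesis
      by (rule has_sum_cong_neutral[THEN iffD1, rotated -1]) (auto simp: a_def)
  qed
  have "(\<lambda>n. pair_cost (PS n)) summable_on UNIV"
    using pair_cost by (intro norm_summable_imp_summable_on) (simp add: pair_cost_nonneg)
  then have sum: "(\<lambda>p. norm (a p) * norm (b p)) summable_on UNIV \<times> UNIV"
    using cost_row by (intro summable_on_SigmaI[where g = "\<lambda>n. pair_cost (PS n)"]) auto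
  have "(\<lambda>p. norm (a p * b p)) summable_on UNIV \<times> UNIV"
    by (rule summable_on_comparison_test[OF sum]) (auto intro: norm_mult_ineq)
  then have "(\<lambda>p. a p * b p) summable_on UNIV \<times> UNIV" by (rule abs_summable_summable)
  moreover have "((\<lambda>n. pair_sum (PS n)) has_sum y) UNIV"
  proof (rule norm_summable_imp_has_sum[OF _ pair_sum])
    have "norm (pair_sum ps) \<le> pair_cost ps" for ps :: "('a \<times> 'a) list"
      by (induction ps) (auto intro!: norm_triangle_le add_mono norm_mult_ineq)
    then show "summable (\<lambda>n. norm (pair_sum (PS n)))"
      using pair_cost by (intro summable_comparison_test'[OF pair_cost, of 0]) auto
  qed
  ultimately have "((\<lambda>p. a p * b p) has_sum y) (UNIV \<times> UNIV)"
    using val_row by (intro has_sum_SigmaI[where g = "\<lambda>n. pair_sum (PS n)"]) auto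
  then have "((\<lambda>m. a (prod_decode m) * b (prod_decode m)) has_sum y) UNIV"
    using has_sum_reindex_bij_betw[OF bij_prod_decode, of "\<lambda>p. a p * b p" y] by simp
  then have "(\<lambda>m. a (prod_decode m) * b (prod_decode m)) sums y" by (rule has_sum_imp_sums)
  moreover have "(\<lambda>m. norm (a (prod_decode m)) * norm (b (prod_decode m))) summable_on UNIV"
    using summable_on_reindex_bij_betw[OF bij_prod_decode, of "\<lambda>p. norm (a p) * norm (b p)"] sum
    by simp
  then have "summable (\<lambda>m. norm (a (prod_decode m)) * norm (b (prod_decode m)))"
    by (rule summable_on_imp_summable)
  ultimately show ?thesis
    unfolding proj_image_def using mem sums_unique
    by (intro CollectI exI[of _ "\<lambda>m. a (prod_decode m)"] exI[of _ "\<lambda>m. b (prod_decode m)"]) auto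
qed

text \<open>The iteration from the proof of the open mapping theorem.  For \<open>M = 2 (K + 1)\<close> a bound \<open>K * norm v\<close>
  on the gauge provides a finite sum of products, of cost at most \<open>(K + 1) * norm v\<close>, that leaves a
  remainder of norm at most \<open>norm v / 2\<close>.  Repeating this on the remainders expands \<open>y\<close> into a
  series with geometrically decreasing costs.\<close>

lemma proj_image_if_gauge_norm_bounded:
  fixes X Y V :: "'a::complex_banach_algebra set"
  assumes zero: "0 \<in> X" "0 \<in> Y" and V_diff: "\<And>x y. x \<in> V \<Longrightarrow> y \<in> V \<Longrightarrow> x - y \<in> V"
    and V_val: "\<And>ps. ps \<in> lists (X \<times> Y) \<Longrightarrow> pair_sum ps \<in> V"
    and K: "K \<ge> 0" and bound: "\<And>y M. y \<in> V \<Longrightarrow> M \<ge> 0 \<Longrightarrow> gauge_norm X Y M y \<le> K * norm y"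
  shows "V \<subseteq> proj_image X Y"
proof
  fix y assume y: "y \<in> V"
  have "\<exists>ps\<in>lists (X \<times> Y). pair_cost ps \<le> (K + 1) * norm v \<and> norm (v - pair_sum ps) \<le> norm v / 2"
    if v: "v \<in> V" for v
  proof (cases "v = 0")
    case True
    then show ?thesis by (intro bexI[of _ "[]"]) auto
  next
    case False
    \<comment> \<open>The strict inequality, which holds as \<open>v\<close> is not zero, yields a list that realizes it.\<close>
    have "gauge_norm X Y (2 * (K + 1)) v < (K + 1) * norm v"
      using bound[OF v, of "2 * (K + 1)"] K False by (simp add: algebra_simps add_strict_increasing)
    moreover have "bdd_below ((\<lambda>ps. pair_cost ps + 2 * (K + 1) * norm (v - pair_sum ps)) ` lists (X \<times> Y))"
      by (intro bdd_belowI2[of _ 0] add_nonneg_nonneg mult_nonneg_nonneg pair_cost_nonneg norm_ge_zero)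
        (use K in auto)
    ultimately obtain ps where ps: "ps \<in> lists (X \<times> Y)"
      "pair_cost ps + 2 * (K + 1) * norm (v - pair_sum ps) < (K + 1) * norm v"
      unfolding gauge_norm_def by (subst (asm) cINF_less_iff) auto
    have "0 \<le> 2 * (K + 1) * norm (v - pair_sum ps)" using K by simp
    with ps(2) have "pair_cost ps \<le> (K + 1) * norm v" by linarith
    moreover have "2 * (K + 1) * norm (v - pair_sum ps) \<le> (K + 1) * norm v"
      using ps(2) pair_cost_nonneg[of ps] by linarith
    then have "(K + 1) * (2 * norm (v - pair_sum ps)) \<le> (K + 1) * norm v" by (simp add: algebra_simps)
    then have "norm (v - pair_sum ps) \<le> norm v / 2" using K by (subst (asm) mult_le_cancel_left_pos) auto
    ultimately show ?thesis using ps(1) by blast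
  qed
  then obtain step where step: "\<And>v. v \<in> V \<Longrightarrow> step v \<in> lists (X \<times> Y)"
    "\<And>v. v \<in> V \<Longrightarrow> pair_cost (step v) \<le> (K + 1) * norm v"
    "\<And>v. v \<in> V \<Longrightarrow> norm (v - pair_sum (step v)) \<le> norm v / 2"
    by metis
  \<comment> \<open>The successive remainders; the sum telescopes to \<open>y\<close> because they tend to zero.\<close>
  define v where "v n = ((\<lambda>v. v - pair_sum (step v)) ^^ n) y" for n
  have v_Suc: "v (Suc n) = v n - pair_sum (step (v n))" for n by (simp add: v_def)
  have vV: "v n \<in> V" for n
    by (induction n) (use y V_diff V_val step(1) v_Suc in \<open>auto simp: v_def\<close>)
  have v_norm: "norm (v n) \<le> norm y * (1 / 2) ^ n" for n
  proof (induction n)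
    case (Suc n)
    then show ?case using step(3)[OF vV[of n]] by (simp add: v_Suc)
  qed (simp add: v_def)
  have geom: "summable (\<lambda>n. norm y * (1 / 2 :: real) ^ n)"
    by (intro summable_mult summable_geometric) simp
  show "y \<in> proj_image X Y"
  proof (rule suminf_pair_sum_in_proj_image)
    show "step (v n) \<in> lists (X \<times> Y)" for n using step(1) vV by blast
    show "summable (\<lambda>n. pair_cost (step (v n)))"
    proof (rule summable_comparison_test'[OF summable_mult[OF geom, of "K + 1"], of 0])
      fix n
      have "pair_cost (step (v n)) \<le> (K + 1) * norm (v n)" using step(2) vV by blast
      also have "\<dots> \<le> (K + 1) * (norm y * (1 / 2) ^ n)"
        using v_norm K by (intro mult_left_mono) auto
      finally show "norm (pair_cost (step (v n))) \<le> (K + 1) * (norm y * (1 / 2) ^ n)"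
        by (simp add: pair_cost_nonneg)
    qed
    have "v \<longlonglongrightarrow> 0"
      using v_norm by (intro Lim_null_comparison[OF _ summable_LIMSEQ_zero[OF geom]]) auto
    then have "(\<lambda>n. v n - v (Suc n)) sums (v 0 - 0)" by (rule telescope_sums')
    then show "(\<lambda>n. pair_sum (step (v n))) sums y" by (simp add: v_Suc) (simp add: v_def)
  qed (use zero in auto)
qed

section \<open>The Peirce decomposition\<close>

text \<open>Here \<open>l a = P a\<close>, \<open>r a = a P\<close>, \<open>l' a = Q a\<close> and \<open>r' a = a Q\<close> for complementary idempotent double
  multipliers \<open>P\<close> and \<open>Q\<close>.  The axioms are symmetric in the two, so a statement about one corner
  yields the statement about the opposite corner.\<close>

locale peirce =
  fixes l r l' r' :: "'a::complex_banach_algebra \<Rightarrow> 'a"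
  assumes op: "bounded_clinear_op l" "bounded_clinear_op r"
      "bounded_clinear_op l'" "bounded_clinear_op r'"
    and l_mult: "l (a * b) = l a * b" and r_mult: "r (a * b) = a * r b"
    and l'_mult: "l' (a * b) = l' a * b" and r'_mult: "r' (a * b) = a * r' b"
    and balance: "a * l b = r a * b" and balance': "a * l' b = r' a * b"
    and comm: "r (l x) = l (r x)" "r' (l x) = l (r' x)" "r (l' x) = l' (r x)" "r' (l' x) = l' (r' x)"
    and idem: "l (l x) = l x" "r (r x) = r x" "l' (l' x) = l' x" "r' (r' x) = r' x"
    and compl: "l x + l' x = x" "r x + r' x = x"
begin

lemma op_add:
  "l (x + y) = l x + l y" "r (x + y) = r x + r y" "l' (x + y) = l' x + l' y" "r' (x + y) = r' x + r' y"
  using op by (simp_all add: bounded_clinear_op_def bounded_linear.linear linear_add)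

lemma op_diff:
  "l (x - y) = l x - l y" "r (x - y) = r x - r y" "l' (x - y) = l' x - l' y" "r' (x - y) = r' x - r' y"
  using op by (simp_all add: bounded_clinear_op_def bounded_linear.linear linear_diff)

lemma op_zero [simp]: "l 0 = 0" "r 0 = 0" "l' 0 = 0" "r' 0 = 0"
  using op_diff[of 0 0] by simp_all

lemma op_scale:
  "l (c *\<^sub>C x) = c *\<^sub>C l x" "r (c *\<^sub>C x) = c *\<^sub>C r x"
  "l' (c *\<^sub>C x) = c *\<^sub>C l' x" "r' (c *\<^sub>C x) = c *\<^sub>C r' x"
  using op by (simp_all add: bounded_clinear_op_def)

lemma l'_eq: "l' x = x - l x" and r'_eq: "r' x = x - r x"
  by (metis compl(1) add_diff_cancel_left') (metis compl(2) add_diff_cancel_left')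

lemma orth: "l (l' x) = 0" "l' (l x) = 0" "r (r' x) = 0" "r' (r x) = 0"
  by (simp_all add: l'_eq r'_eq op_diff idem)

lemmas peirce_simps = comm idem orth

lemma swap: "peirce l' r' l r"
  by unfold_locales
    (simp_all add: op l_mult r_mult l'_mult r'_mult balance balance' peirce_simps compl add.commute)

text \<open>The decomposition into \<open>PAP + QAQ\<close> and \<open>PAQ + QAP\<close> is a grading modulo 2, with the off-diagonal
  part as the odd part.\<close>

definition odd_elements :: "'a set" where
  "odd_elements = {x. l (r x) = 0 \<and> l' (r' x) = 0}"

text \<open>These generate the ideal \<open>J = PAQ + QAP + span (PAQ QAP) + span (QAP PAQ)\<close>, with a norm equivalent
  to the norm of \<open>A\<close> on the odd part and to the projective norm on the even part.\<close>

definition odd_generators :: "'a set" where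
  "odd_generators = {u \<in> odd_elements. norm u \<le> 1} \<union>
     {u * v | u v. u \<in> odd_elements \<and> v \<in> odd_elements \<and> norm u \<le> 1 \<and> norm v \<le> 1}"

abbreviation "J \<equiv> cspan odd_generators"
abbreviation "Z \<equiv> functional_module odd_generators (*) (\<lambda>a x. x * a)"
abbreviation "CZ \<equiv> bm_carrier Z"

lemma swap_odd_generators: "peirce.odd_generators l' r' l r = odd_generators"
  unfolding odd_generators_def odd_elements_def
    peirce.odd_generators_def[OF swap] peirce.odd_elements_def[OF swap]
  by auto

lemma odd_zero: "0 \<in> odd_elements"
  and odd_scale: "x \<in> odd_elements \<Longrightarrow> c *\<^sub>C x \<in> odd_elements"
  by (auto simp: odd_elements_def op_scale)

lemma odd_l: assumes "u \<in> odd_elements"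
  shows "r (l u) = 0" "r' (l' u) = 0" "r' (l u) = l u" "r (l' u) = l' u"
proof -
  show 0: "r (l u) = 0" "r' (l' u) = 0" using assms by (simp_all add: odd_elements_def comm)
  show "r' (l u) = l u" using r'_eq[of "l u"] 0(1) by simp
  show "r (l' u) = l' u" using r'_eq[of "l' u"] 0(2) by simp
qed

lemma odd_r: assumes "u \<in> odd_elements"
  shows "l (r u) = 0" "l' (r' u) = 0" "l' (r u) = r u" "l (r' u) = r' u"
proof -
  show 0: "l (r u) = 0" "l' (r' u) = 0" using assms by (simp_all add: odd_elements_def)
  show "l' (r u) = r u" using l'_eq[of "r u"] 0(1) by simp
  show "l (r' u) = r' u" using l'_eq[of "r' u"] 0(2) by simp
qed

definition even_part :: "'a \<Rightarrow> 'a" where "even_part x = l (r x) + l' (r' x)"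
definition odd_part :: "'a \<Rightarrow> 'a" where "odd_part x = l (r' x) + l' (r x)"

lemma even_odd: "even_part x + odd_part x = x"
proof -
  have "even_part x + odd_part x = (l (r x) + l (r' x)) + (l' (r x) + l' (r' x))"
    by (simp add: even_part_def odd_part_def)
  also have "\<dots> = l (r x + r' x) + l' (r x + r' x)" by (simp add: op_add)
  finally show ?thesis by (simp add: compl)
qed

lemma odd_part_mem: "odd_part x \<in> odd_elements"
  by (simp add: odd_elements_def odd_part_def op_add peirce_simps)

lemma even_part_mult: assumes "u \<in> odd_elements" shows "even_part a * u \<in> odd_elements"
proof -
  have "l (r a) * r u = 0" using balance[of "l a" "r u"] odd_r[OF assms] by (simp add: comm)
  moreover have "l' (r' a) * r' u = 0"
    using balance'[of "l' a" "r' u"] odd_r[OF assms] by (simp add: comm)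
  ultimately show ?thesis
    by (simp add: odd_elements_def even_part_def l_mult r_mult l'_mult r'_mult op_add peirce_simps)
qed

lemma mult_even_part: assumes "u \<in> odd_elements" shows "u * even_part a \<in> odd_elements"
proof -
  have "l u * l (r a) = 0" using balance[of "l u" "r a"] odd_l[OF assms] by simp
  moreover have "l' u * l' (r' a) = 0"
    using balance'[of "l' u" "r' a"] odd_l[OF assms] by simp
  ultimately show ?thesis
    by (simp add: odd_elements_def even_part_def l_mult r_mult l'_mult r'_mult op_add peirce_simps)
qed

lemma odd_mult_odd: assumes "u \<in> odd_elements" "v \<in> odd_elements" shows "u * v = even_part (u * v)"
proof -
  have "l u * r' v = 0"
    using balance[of "l u" "r' v"] odd_l[OF assms(1)] odd_r[OF assms(2)] by simp
  moreover have "l' u * r v = 0"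
    using balance'[of "l' u" "r v"] odd_l[OF assms(1)] odd_r[OF assms(2)] by simp
  ultimately have "odd_part (u * v) = 0"
    by (simp add: odd_part_def l_mult r_mult l'_mult r'_mult)
  with even_odd[of "u * v"] show ?thesis by simp
qed

lemma odd3:
  assumes "u \<in> odd_elements" "v \<in> odd_elements" "w \<in> odd_elements"
  shows "u * v * w \<in> odd_elements" "u * (v * w) \<in> odd_elements"
  using even_part_mult[OF assms(3), of "u * v"] odd_mult_odd[OF assms(1,2)]
  by (simp_all add: mult.assoc)

lemma op_bound:
  obtains C where "C \<ge> 1" "\<And>x. norm (l x) \<le> C * norm x" "\<And>x. norm (r x) \<le> C * norm x"
    "\<And>x. norm (l' x) \<le> C * norm x" "\<And>x. norm (r' x) \<le> C * norm x"
proof -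
  have *: "\<exists>K. \<forall>C\<ge>K. \<forall>x. norm (T x) \<le> C * norm x" if "bounded_clinear_op T" for T :: "'a \<Rightarrow> 'a"
  proof -
    have "bounded_linear T" using that by (simp add: bounded_clinear_op_def)
    then obtain K where K: "\<And>x. norm (T x) \<le> norm x * K" using bounded_linear.bounded by blast
    have "norm (T x) \<le> C * norm x" if "C \<ge> K" for C x
      using K[of x] mult_left_mono[OF that norm_ge_zero[of x]] by (simp add: mult.commute)
    then show ?thesis by blast
  qed
  obtain K1 K2 K3 K4 where K: "\<And>C x. C \<ge> K1 \<Longrightarrow> norm (l x) \<le> C * norm x"
    "\<And>C x. C \<ge> K2 \<Longrightarrow> norm (r x) \<le> C * norm x" "\<And>C x. C \<ge> K3 \<Longrightarrow> norm (l' x) \<le> C * norm x"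
    "\<And>C x. C \<ge> K4 \<Longrightarrow> norm (r' x) \<le> C * norm x"
    using op[THEN *] by blast
  show ?thesis
    by (rule that[of "max 1 (max (max K1 K2) (max K3 K4))"]) (auto intro!: K)
qed

lemma odd_hull: assumes "x \<in> odd_elements" "norm x \<le> t" shows "\<exists>g\<in>odd_generators. x = of_real t *\<^sub>C g"
proof -
  obtain y where y: "x = of_real t *\<^sub>C y" "norm y \<le> 1" "y = of_real (inverse t) *\<^sub>C x"
    by (rule scaleC_normalize[OF assms(2)])
  have "y \<in> odd_elements" unfolding y(3) by (rule odd_scale[OF assms(1)])
  with y(1,2) show ?thesis unfolding odd_generators_def by blast
qed

lemma odd_mult_hull:
  assumes "u \<in> odd_elements" "v \<in> odd_elements" "norm u \<le> s" "norm v \<le> t"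
  shows "\<exists>g\<in>odd_generators. u * v = of_real (s * t) *\<^sub>C g"
proof -
  obtain u1 where u1: "u = of_real s *\<^sub>C u1" "norm u1 \<le> 1" "u1 = of_real (inverse s) *\<^sub>C u"
    by (rule scaleC_normalize[OF assms(3)])
  obtain v1 where v1: "v = of_real t *\<^sub>C v1" "norm v1 \<le> 1" "v1 = of_real (inverse t) *\<^sub>C v"
    by (rule scaleC_normalize[OF assms(4)])
  have "u1 \<in> odd_elements" "v1 \<in> odd_elements" unfolding u1(3) v1(3) by (intro odd_scale assms)+
  then have "u1 * v1 \<in> odd_generators" using u1 v1 unfolding odd_generators_def by blast
  moreover have "u * v = of_real (s * t) *\<^sub>C (u1 * v1)"
    by (subst u1(1), subst v1(1)) (simp add: mult_scaleC_left mult_scaleC_right scaleC_scaleC mult.commute)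
  ultimately show ?thesis by blast
qed

lemma odd_generators_norm: "g \<in> odd_generators \<Longrightarrow> norm g \<le> 1"
  unfolding odd_generators_def
  by (auto intro!: order_trans[OF norm_mult_ineq] mult_le_one)

lemma part_bound:
  obtains K where "K \<ge> 0" "\<And>a. norm (even_part a) \<le> K * norm a" "\<And>a. norm (odd_part a) \<le> K * norm a"
proof -
  obtain C where C: "C \<ge> 1" "\<And>x. norm (l x) \<le> C * norm x" "\<And>x. norm (r x) \<le> C * norm x"
    "\<And>x. norm (l' x) \<le> C * norm x" "\<And>x. norm (r' x) \<le> C * norm x" using op_bound by blast
  have 2: "norm (S (T a)) \<le> C * C * norm a"
    if "\<And>x. norm (S x) \<le> C * norm x" "\<And>x. norm (T x) \<le> C * norm x" for S T :: "'a \<Rightarrow> 'a" and a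
    using order_trans[OF that(1) mult_left_mono[OF that(2)]] C(1) by (simp add: mult.assoc)
  have "norm (even_part a) \<le> 2 * C * C * norm a" "norm (odd_part a) \<le> 2 * C * C * norm a" for a
    using norm_triangle_mono[OF 2[OF C(2,3), of a] 2[OF C(4,5), of a]]
      norm_triangle_mono[OF 2[OF C(2,5), of a] 2[OF C(4,3), of a]]
    by (simp_all add: even_part_def odd_part_def)
  then show ?thesis using that[of "2 * C * C"] C(1) by simp
qed

text \<open>Split \<open>a\<close> into its even and odd parts.  An even factor is absorbed into a neighbouring odd factor.
  An odd factor turns an odd generator into a product of two odd elements, and a product of two odd
  elements into an odd element.  So \<open>J\<close> is an ideal on which both multiplications are bounded.\<close>

lemma acting_pair_odd: "acting_pair odd_generators (*) (\<lambda>a x. x * a)"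
proof
  have "0 \<in> odd_generators" using odd_zero by (simp add: odd_generators_def)
  then show "odd_generators \<noteq> {}" by blast
  obtain K where K: "K \<ge> 0" "\<And>a. norm (even_part a) \<le> K * norm a"
    "\<And>a. norm (odd_part a) \<le> K * norm a" using part_bound by blast
  have combine: "\<exists>c d. \<exists>g\<in>odd_generators. \<exists>h\<in>odd_generators.
      x = c *\<^sub>C g + d *\<^sub>C h \<and> cmod c + cmod d \<le> 2 * K * norm a"
    if "\<exists>g\<in>odd_generators. y = of_real (K * norm a) *\<^sub>C g"
      "\<exists>h\<in>odd_generators. z = of_real (K * norm a) *\<^sub>C h" "x = y + z" for x y z a
  proof -
    have "cmod (of_real (K * norm a)) + cmod (of_real (K * norm a)) \<le> 2 * K * norm a"
      using K(1) by (simp add: norm_mult)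
    then show ?thesis using that by blast
  qed
  have mult_le: "norm (x * y) \<le> s" if "norm x \<le> s" "norm y \<le> 1" for x y :: 'a and s
    using norm_mult_ineq[of x y] mult_left_mono[OF that(2), of "norm x"] that(1) by simp
  have mult_le': "norm (y * x) \<le> s" if "norm x \<le> s" "norm y \<le> 1" for x y :: 'a and s
    using norm_mult_ineq[of y x] mult_right_mono[OF that(2), of "norm x"] that(1) by simp
  have "\<exists>c d. \<exists>g'\<in>odd_generators. \<exists>h\<in>odd_generators.
      a * g = c *\<^sub>C g' + d *\<^sub>C h \<and> cmod c + cmod d \<le> 2 * K * norm a"
    if "g \<in> odd_generators" for a g
  proof -
    from that consider (one) "g \<in> odd_elements" "norm g \<le> 1"
      | (two) u v where "g = u * v" "u \<in> odd_elements" "v \<in> odd_elements" "norm u \<le> 1" "norm v \<le> 1"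
      unfolding odd_generators_def by blast
    then show ?thesis
    proof cases
      case g: one
      show ?thesis
      proof (rule combine)
        show "\<exists>h\<in>odd_generators. even_part a * g = of_real (K * norm a) *\<^sub>C h"
          using g by (intro odd_hull even_part_mult mult_le K)
        show "\<exists>h\<in>odd_generators. odd_part a * g = of_real (K * norm a) *\<^sub>C h"
          using odd_mult_hull[OF odd_part_mem g(1) K(3) g(2), of a] by simp
        show "a * g = even_part a * g + odd_part a * g"
          by (simp add: even_odd flip: distrib_right)
      qed
    next
      case g: (two u v)
      have uv: "norm (u * v) \<le> 1" using mult_le[OF g(4) g(5)] .
      show ?thesis
      proof (rule combine)
        show "\<exists>h\<in>odd_generators. (even_part a * u) * v = of_real (K * norm a) *\<^sub>C h"
          using odd_mult_hull[OF even_part_mult[OF g(2)] g(3) mult_le[OF K(2) g(4)] g(5), of a] by simp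
        show "\<exists>h\<in>odd_generators. odd_part a * (u * v) = of_real (K * norm a) *\<^sub>C h"
          using g by (intro odd_hull odd3 odd_part_mem mult_le K uv)
        show "a * g = (even_part a * u) * v + odd_part a * (u * v)"
          by (simp add: g(1) mult.assoc even_odd flip: distrib_right)
      qed
    qed
  qed
  then show "\<exists>K. \<forall>a. \<forall>g\<in>odd_generators. \<exists>c d. \<exists>g'\<in>odd_generators. \<exists>h\<in>odd_generators.
      a * g = c *\<^sub>C g' + d *\<^sub>C h \<and> cmod c + cmod d \<le> K * norm a" by blast
  have "\<exists>c d. \<exists>g'\<in>odd_generators. \<exists>h\<in>odd_generators.
      g * a = c *\<^sub>C g' + d *\<^sub>C h \<and> cmod c + cmod d \<le> 2 * K * norm a"
    if "g \<in> odd_generators" for a g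
  proof -
    from that consider (one) "g \<in> odd_elements" "norm g \<le> 1"
      | (two) u v where "g = u * v" "u \<in> odd_elements" "v \<in> odd_elements" "norm u \<le> 1" "norm v \<le> 1"
      unfolding odd_generators_def by blast
    then show ?thesis
    proof cases
      case g: one
      show ?thesis
      proof (rule combine)
        show "\<exists>h\<in>odd_generators. g * even_part a = of_real (K * norm a) *\<^sub>C h"
          using g by (intro odd_hull mult_even_part mult_le' K)
        show "\<exists>h\<in>odd_generators. g * odd_part a = of_real (K * norm a) *\<^sub>C h"
          using odd_mult_hull[OF g(1) odd_part_mem g(2) K(3), of a] by simp
        show "g * a = g * even_part a + g * odd_part a"
          by (simp add: even_odd flip: distrib_left)
      qed
    next
      case g: (two u v)
      have uv: "norm (u * v) \<le> 1" using mult_le[OF g(4) g(5)] .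
      show ?thesis
      proof (rule combine)
        show "\<exists>h\<in>odd_generators. u * (v * even_part a) = of_real (K * norm a) *\<^sub>C h"
          using odd_mult_hull[OF g(2) mult_even_part[OF g(3)] g(4) mult_le'[OF K(2) g(5)], of a] by simp
        show "\<exists>h\<in>odd_generators. (u * v) * odd_part a = of_real (K * norm a) *\<^sub>C h"
          using g by (intro odd_hull odd3 odd_part_mem mult_le' K uv)
        show "g * a = u * (v * even_part a) + (u * v) * odd_part a"
          by (simp add: g(1) mult.assoc even_odd flip: distrib_left)
      qed
    qed
  qed
  then show "\<exists>K. \<forall>a. \<forall>g\<in>odd_generators. \<exists>c d. \<exists>g'\<in>odd_generators. \<exists>h\<in>odd_generators.
      g * a = c *\<^sub>C g' + d *\<^sub>C h \<and> cmod c + cmod d \<le> K * norm a" by blast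
qed (simp_all add: algebra_simps mult_scaleC_left mult_scaleC_right)

subsection \<open>Compression of functionals to the corners\<close>

interpretation odd_module: acting_pair odd_generators "(*)" "\<lambda>a x. x * a"
  by (rule acting_pair_odd)

text \<open>The corners \<open>PAP\<close> and \<open>PAQ\<close>; the same definitions with \<open>P\<close> and \<open>Q\<close> exchanged give \<open>QAQ\<close> and \<open>QAP\<close>.\<close>

definition corner11 :: "'a set" where "corner11 = {x. l x = x \<and> r x = x}"
definition corner12 :: "'a set" where "corner12 = {x. l x = x \<and> r' x = x}"

lemma proj_image_subset_corner11: "proj_image corner12 (peirce.corner12 l' r) \<subseteq> corner11"
proof
  fix x assume "x \<in> proj_image corner12 (peirce.corner12 l' r)"
  then obtain a b where x: "x = (\<Sum>n. a n * b n)" and ab: "\<And>n. a n \<in> corner12" "\<And>n. b n \<in> peirce.corner12 l' r"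
    and sum: "summable (\<lambda>n. norm (a n) * norm (b n))"
    unfolding proj_image_def by blast
  have s: "summable (\<lambda>n. a n * b n)"
    by (rule summable_comparison_test'[OF sum, of 0]) (rule norm_mult_ineq)
  have bl: "bounded_linear l" "bounded_linear r" using op by (auto simp: bounded_clinear_op_def)
  show "x \<in> corner11"
    using ab bounded_linear.suminf[OF bl(1) s] bounded_linear.suminf[OF bl(2) s]
    by (simp add: x corner11_def corner12_def peirce.corner12_def[OF swap] l_mult r_mult)
qed

lemma restrict_mem:
  assumes f: "bounded_cfunctional f" and K: "\<And>g. g \<in> odd_generators \<Longrightarrow> cmod (f g) \<le> K"
  shows "(\<lambda>x\<in>J. f x) \<in> CZ" "bm_norm Z (\<lambda>x\<in>J. f x) \<le> K"
proof -
  show "(\<lambda>x\<in>J. f x) \<in> CZ"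
    by (rule odd_module.carrierI[where K = K])
      (auto simp: bcf_add[OF f] bcf_scale[OF f] K cspan.intros)
  show "bm_norm Z (\<lambda>x\<in>J. f x) \<le> K"
    by (rule odd_module.norm_least) (simp add: cspan_base K)
qed

lemma bcf_restrict_mem: assumes f: "bounded_cfunctional f" shows "(\<lambda>x\<in>J. f x) \<in> CZ"
proof -
  obtain K where K: "K \<ge> 0" "\<And>x. cmod (f x) \<le> K * norm x" using bcf_bound[OF f] by blast
  have "cmod (f g) \<le> K" if "g \<in> odd_generators" for g
    using order_trans[OF K(2) mult_left_mono[OF odd_generators_norm[OF that] K(1)]] by simp
  then show ?thesis by (rule restrict_mem(1)[OF f])
qed

context
  fixes \<Theta> assumes \<Theta>: "\<Theta> \<in> bm_carrier (bm_dual Z)"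
begin

lemma \<Theta>_add: "f \<in> CZ \<Longrightarrow> h \<in> CZ \<Longrightarrow> \<Theta> (\<lambda>x\<in>J. f x + h x) = \<Theta> f + \<Theta> h"
  and \<Theta>_scale: "f \<in> CZ \<Longrightarrow> \<Theta> (\<lambda>x\<in>J. c * f x) = c * \<Theta> f"
  using \<Theta> by (auto simp: bm_dual_def odd_module.ops)

lemma \<Theta>_bound: obtains B where "B \<ge> 0" "\<And>f. f \<in> CZ \<Longrightarrow> cmod (\<Theta> f) \<le> B * bm_norm Z f"
proof -
  obtain B where B: "\<And>f. f \<in> CZ \<Longrightarrow> cmod (\<Theta> f) \<le> B * bm_norm Z f"
    using \<Theta> unfolding bm_dual_def by auto metis
  have "cmod (\<Theta> f) \<le> max B 0 * bm_norm Z f" if "f \<in> CZ" for f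
    using order_trans[OF B[OF that] mult_right_mono[OF max.cobounded1 odd_module.norm_ge_0[OF that]]] .
  then show ?thesis using that[of "max B 0"] by simp
qed

text \<open>The compression \<open>\<Phi> = P \<Theta> P\<close>, which sends a functional \<open>\<psi>\<close> on \<open>PAP\<close> to the value of \<open>\<Theta>\<close> at
  \<open>x \<mapsto> \<psi> (P x P)\<close>, belongs to the bidual of \<open>PAP\<close> and commutes with \<open>PAP\<close> if \<open>\<Theta>\<close> does.  A trivial
  virtual centre makes it act as a scalar.\<close>

lemma virtual_centre_scalar:
  assumes tvc: "trivial_virtual_centre corner11"
    and central: "\<And>b f. b \<in> corner11 \<Longrightarrow> f \<in> CZ \<Longrightarrow> \<Theta> (\<lambda>x\<in>J. f (b * x)) = \<Theta> (\<lambda>x\<in>J. f (x * b))"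
  obtains c where "\<And>f b. bounded_cfunctional f \<Longrightarrow> b \<in> corner11 \<Longrightarrow> \<Theta> (\<lambda>x\<in>J. f (b * l (r x))) = c * f b"
    "\<And>f b. bounded_cfunctional f \<Longrightarrow> b \<in> corner11 \<Longrightarrow> \<Theta> (\<lambda>x\<in>J. f (l (r x) * b)) = c * f b"
proof -
  let ?S = "bm_self corner11"
  let ?D = "bm_carrier (bm_dual ?S)"
  let ?BB = "bm_dual (bm_dual ?S)"
  obtain C where C: "C \<ge> 1" "\<And>x. norm (l x) \<le> C * norm x" "\<And>x. norm (r x) \<le> C * norm x"
    using op_bound by metis
  obtain B where B: "B \<ge> 0" "\<And>f. f \<in> CZ \<Longrightarrow> cmod (\<Theta> f) \<le> B * bm_norm Z f"
    using \<Theta>_bound by blast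
  have corner11_lr: "l (r x) \<in> corner11" for x by (simp add: corner11_def peirce_simps)
  have corner11_add: "x + y \<in> corner11" if "x \<in> corner11" "y \<in> corner11" for x y
    using that by (simp add: corner11_def op_add)
  have corner11_scale: "c *\<^sub>C x \<in> corner11" if "x \<in> corner11" for c x
    using that by (simp add: corner11_def op_scale)
  have corner11_mult: "x * y \<in> corner11" if "x \<in> corner11" "y \<in> corner11" for x y
    using that by (simp add: corner11_def l_mult r_mult)
  have D_iff: "\<psi> \<in> ?D \<longleftrightarrow> \<psi> \<in> extensional corner11 \<and>
      (\<forall>x\<in>corner11. \<forall>y\<in>corner11. \<psi> (x + y) = \<psi> x + \<psi> y) \<and> (\<forall>c. \<forall>x\<in>corner11. \<psi> (c *\<^sub>C x) = c * \<psi> x) \<and>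
      (\<exists>K. \<forall>x\<in>corner11. cmod (\<psi> x) \<le> K * norm x)" for \<psi>
    by (auto simp: bm_dual_def bm_self_def)
  have D_upper: "cmod (\<psi> x) \<le> bm_norm (bm_dual ?S) \<psi>"
    if \<psi>: "\<psi> \<in> ?D" and x: "x \<in> corner11" "norm x \<le> 1" for \<psi> x
  proof -
    obtain K where K: "\<forall>x\<in>corner11. cmod (\<psi> x) \<le> K * norm x" using \<psi> D_iff by blast
    have bdd: "bdd_above ((\<lambda>x. cmod (\<psi> x)) ` {x \<in> corner11. norm x \<le> 1})"
    proof (rule bdd_aboveI2)
      fix x assume x: "x \<in> {x \<in> corner11. norm x \<le> 1}"
      then have "cmod (\<psi> x) \<le> K * norm x" using K by blast
      also have "\<dots> \<le> \<bar>K\<bar> * 1" using x by (intro mult_mono) auto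
      finally show "cmod (\<psi> x) \<le> \<bar>K\<bar>" by simp
    qed
    show ?thesis
      using cSUP_upper[OF _ bdd, of x] x by (simp add: bm_dual_def bm_self_def)
  qed
  have D_norm_nonneg: "0 \<le> bm_norm (bm_dual ?S) \<psi>" if "\<psi> \<in> ?D" for \<psi>
    using D_upper[OF that, of 0] by (simp add: corner11_def) (meson norm_ge_zero order_trans)
  have \<psi>_le: "cmod (\<psi> x) \<le> bm_norm (bm_dual ?S) \<psi> * norm x" if \<psi>: "\<psi> \<in> ?D" and x: "x \<in> corner11" for \<psi> x
  proof -
    obtain y where y: "x = of_real (norm x) *\<^sub>C y" "norm y \<le> 1" "y = of_real (inverse (norm x)) *\<^sub>C x"
      by (rule scaleC_normalize[of x "norm x"]) auto
    have "y \<in> corner11" unfolding y(3) by (rule corner11_scale[OF x])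
    then have "\<psi> (of_real (norm x) *\<^sub>C y) = of_real (norm x) * \<psi> y" using \<psi> unfolding D_iff by blast
    then have "cmod (\<psi> x) = norm x * cmod (\<psi> y)" by (simp add: norm_mult flip: y(1))
    also have "\<dots> \<le> norm x * bm_norm (bm_dual ?S) \<psi>"
      using D_upper[OF \<psi> \<open>y \<in> corner11\<close> y(2)] by (simp add: mult_left_mono)
    finally show ?thesis by (simp add: mult.commute)
  qed
  \<comment> \<open>Pulling a functional on \<open>PAP\<close> back along the compression \<open>x \<mapsto> P x P\<close>.\<close>
  define F where "F \<psi> = (\<lambda>x\<in>J. \<psi> (l (r x)))" for \<psi> :: "'a \<Rightarrow> complex"
  have F_le: "cmod (\<psi> (l (r g))) \<le> C * C * bm_norm (bm_dual ?S) \<psi>"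
    if \<psi>: "\<psi> \<in> ?D" and g: "g \<in> odd_generators" for \<psi> g
  proof -
    have "norm (l (r g)) \<le> C * (C * norm g)"
      using order_trans[OF C(2) mult_left_mono[OF C(3)]] C(1) by simp
    also have "\<dots> \<le> C * C" using odd_generators_norm[OF g] C(1)
      by (simp add: mult_left_le)
    finally have *: "norm (l (r g)) \<le> C * C" .
    show ?thesis
      using order_trans[OF \<psi>_le[OF \<psi> corner11_lr] mult_left_mono[OF * D_norm_nonneg[OF \<psi>]]]
      by (simp add: mult_ac)
  qed
  have F_mem: "F \<psi> \<in> CZ" if \<psi>: "\<psi> \<in> ?D" for \<psi>
    unfolding F_def
  proof (rule odd_module.carrierI)
    fix g assume "g \<in> odd_generators"
    then show "cmod ((\<lambda>x\<in>J. \<psi> (l (r x))) g) \<le> C * C * bm_norm (bm_dual ?S) \<psi>"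
      using F_le[OF \<psi>] by (simp add: cspan_base)
  qed (use \<psi> corner11_lr in \<open>auto simp: D_iff op_add op_scale cspan.intros\<close>)
  have F_norm: "bm_norm Z (F \<psi>) \<le> C * C * bm_norm (bm_dual ?S) \<psi>" if \<psi>: "\<psi> \<in> ?D" for \<psi>
    by (rule odd_module.norm_least) (use F_le[OF \<psi>] in \<open>simp add: F_def cspan_base\<close>)
  define \<Phi> where "\<Phi> = (\<lambda>\<psi>\<in>?D. \<Theta> (F \<psi>))"
  have D_ops: "bm_add (bm_dual ?S) \<psi> \<xi> = (\<lambda>x\<in>corner11. \<psi> x + \<xi> x)"
    "bm_scale (bm_dual ?S) c \<psi> = (\<lambda>x\<in>corner11. c * \<psi> x)"
    "bm_ract (bm_dual ?S) \<psi> b = (\<lambda>x\<in>corner11. \<psi> (b * x))"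
    "bm_lact (bm_dual ?S) b \<psi> = (\<lambda>x\<in>corner11. \<psi> (x * b))" for \<psi> \<xi> c b
    by (auto simp: bm_dual_def bm_self_def)
  have D_add: "(\<lambda>x\<in>corner11. \<psi> x + \<xi> x) \<in> ?D" if \<psi>: "\<psi> \<in> ?D" and \<xi>: "\<xi> \<in> ?D" for \<psi> \<xi>
  proof -
    obtain K1 K2 where "\<forall>x\<in>corner11. cmod (\<psi> x) \<le> K1 * norm x" "\<forall>x\<in>corner11. cmod (\<xi> x) \<le> K2 * norm x"
      using \<psi> \<xi> D_iff by meson
    then have "\<forall>x\<in>corner11. cmod (\<psi> x + \<xi> x) \<le> (K1 + K2) * norm x"
      by (metis distrib_right norm_triangle_mono)
    then show ?thesis using \<psi> \<xi>
      by (auto simp: D_iff corner11_add corner11_scale algebra_simps intro!: exI[of _ "K1 + K2"])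
  qed
  have D_scale: "(\<lambda>x\<in>corner11. c * \<psi> x) \<in> ?D" if \<psi>: "\<psi> \<in> ?D" for \<psi> c
  proof -
    obtain K where "\<forall>x\<in>corner11. cmod (\<psi> x) \<le> K * norm x" using \<psi> D_iff by meson
    then have "\<forall>x\<in>corner11. cmod (c * \<psi> x) \<le> (cmod c * K) * norm x"
      by (simp add: norm_mult mult.assoc mult_left_mono)
    then show ?thesis using \<psi>
      by (auto simp: D_iff corner11_add corner11_scale algebra_simps intro!: exI[of _ "cmod c * K"])
  qed
  have D_compose: "(\<lambda>x\<in>corner11. \<psi> (T x)) \<in> ?D"
    if \<psi>: "\<psi> \<in> ?D" and T: "bounded_clinear_op T" "\<And>x. x \<in> corner11 \<Longrightarrow> T x \<in> corner11" for \<psi> T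
  proof -
    have bl: "bounded_linear T" and sc: "\<And>c x. T (c *\<^sub>C x) = c *\<^sub>C T x"
      using T(1) by (auto simp: bounded_clinear_op_def)
    obtain k where k: "\<And>x. norm (T x) \<le> norm x * k" using bounded_linear.bounded[OF bl] by blast
    obtain K where K: "\<forall>x\<in>corner11. cmod (\<psi> x) \<le> K * norm x" using \<psi> D_iff by meson
    have "cmod (\<psi> (T x)) \<le> (\<bar>K\<bar> * k) * norm x" if "x \<in> corner11" for x
    proof -
      have "cmod (\<psi> (T x)) \<le> K * norm (T x)" using K T(2)[OF that] by blast
      also have "\<dots> \<le> \<bar>K\<bar> * (norm x * k)" using k by (intro mult_mono) auto
      finally show ?thesis by (simp add: mult_ac)
    qed
    then show ?thesis using \<psi> T(2)
      by (auto simp: D_iff corner11_add corner11_scale sc linear_add[OF bounded_linear.linear[OF bl]])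
  qed
  have D_mult: "(\<lambda>x\<in>corner11. \<psi> (b * x)) \<in> ?D" "(\<lambda>x\<in>corner11. \<psi> (x * b)) \<in> ?D"
    if "\<psi> \<in> ?D" "b \<in> corner11" for \<psi> b
    using D_compose[OF that(1) clinear_op_mult_left[of b]] D_compose[OF that(1) clinear_op_mult_right[of b]]
      corner11_mult that(2) by blast+
  have \<Phi>_mem: "\<Phi> \<in> bm_carrier ?BB"
  proof -
    have "\<Phi> (\<lambda>x\<in>corner11. \<psi> x + \<xi> x) = \<Phi> \<psi> + \<Phi> \<xi>" if "\<psi> \<in> ?D" "\<xi> \<in> ?D" for \<psi> \<xi>
    proof -
      have "F (\<lambda>x\<in>corner11. \<psi> x + \<xi> x) = (\<lambda>x\<in>J. F \<psi> x + F \<xi> x)"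
        by (auto simp: F_def corner11_lr)
      then show ?thesis using that by (simp add: \<Phi>_def D_add \<Theta>_add F_mem)
    qed
    moreover have "\<Phi> (\<lambda>x\<in>corner11. c * \<psi> x) = c * \<Phi> \<psi>" if "\<psi> \<in> ?D" for \<psi> c
    proof -
      have "F (\<lambda>x\<in>corner11. c * \<psi> x) = (\<lambda>x\<in>J. c * F \<psi> x)"
        by (auto simp: F_def corner11_lr)
      then show ?thesis using that by (simp add: \<Phi>_def D_scale \<Theta>_scale F_mem)
    qed
    moreover have "cmod (\<Phi> \<psi>) \<le> (B * (C * C)) * bm_norm (bm_dual ?S) \<psi>" if "\<psi> \<in> ?D" for \<psi>
      using order_trans[OF B(2)[OF F_mem[OF that]] mult_left_mono[OF F_norm[OF that] B(1)]] that
      by (simp add: \<Phi>_def mult_ac)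
    moreover have "\<Phi> \<in> extensional ?D" by (simp add: \<Phi>_def)
    ultimately show ?thesis
      unfolding bm_dual_def[of "bm_dual ?S"] by (simp add: D_ops) blast
  qed
  have BB_ops: "bm_lact ?BB b \<Phi> = (\<lambda>\<psi>\<in>?D. \<Phi> (\<lambda>x\<in>corner11. \<psi> (b * x)))"
    "bm_ract ?BB \<Phi> b = (\<lambda>\<psi>\<in>?D. \<Phi> (\<lambda>x\<in>corner11. \<psi> (x * b)))" for b
    unfolding bm_dual_def[of "bm_dual ?S"] by (simp_all add: D_ops)
  have lr_mult: "l (r (b * x)) = b * l (r x)" "l (r (x * b)) = l (r x) * b" if b: "b \<in> corner11" for b x
  proof -
    have "l b = b" "r b = b" using b by (auto simp: corner11_def)
    have "l (r (b * x)) = b * r x" by (simp add: r_mult l_mult \<open>l b = b\<close>)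
    also have "\<dots> = b * l (r x)" using balance[of b "r x"] \<open>r b = b\<close> by simp
    finally show "l (r (b * x)) = b * l (r x)" .
    have "l (r (x * b)) = l x * b" by (simp add: r_mult l_mult \<open>r b = b\<close>)
    also have "\<dots> = l (r x) * b" using balance[of "l x" b] \<open>l b = b\<close> by (simp add: comm)
    finally show "l (r (x * b)) = l (r x) * b" .
  qed
  have F_left: "F (\<lambda>x\<in>corner11. \<psi> (b * x)) = (\<lambda>x\<in>J. F \<psi> (b * x))"
    and F_right: "F (\<lambda>x\<in>corner11. \<psi> (x * b)) = (\<lambda>x\<in>J. F \<psi> (x * b))" if "b \<in> corner11" for b \<psi>
    using odd_module.L_mem_J odd_module.R_mem_J
    by (auto simp: F_def corner11_lr lr_mult[OF that])
  have "bm_lact ?BB b \<Phi> = bm_ract ?BB \<Phi> b" if b: "b \<in> corner11" for b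
  proof -
    have "\<Phi> (\<lambda>x\<in>corner11. \<psi> (b * x)) = \<Phi> (\<lambda>x\<in>corner11. \<psi> (x * b))" if \<psi>: "\<psi> \<in> ?D" for \<psi>
      using central[OF b F_mem[OF \<psi>]] by (simp add: \<Phi>_def D_mult[OF \<psi> b] F_left[OF b] F_right[OF b])
    then show ?thesis unfolding BB_ops by auto
  qed
  then obtain c where c: "\<And>b. b \<in> corner11 \<Longrightarrow> bm_lact ?BB b \<Phi> = bm_canonical ?S (c *\<^sub>C b)"
      "\<And>b. b \<in> corner11 \<Longrightarrow> bm_ract ?BB \<Phi> b = bm_canonical ?S (c *\<^sub>C b)"
    using tvc \<Phi>_mem unfolding trivial_virtual_centre_def Let_def by blast
  have "\<Theta> (\<lambda>x\<in>J. f (b * l (r x))) = c * f b \<and> \<Theta> (\<lambda>x\<in>J. f (l (r x) * b)) = c * f b"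
    if f: "bounded_cfunctional f" and b: "b \<in> corner11" for f b
  proof -
    let ?\<psi> = "\<lambda>x\<in>corner11. f x"
    have \<psi>: "?\<psi> \<in> ?D"
    proof -
      obtain K where "\<And>x. cmod (f x) \<le> K * norm x" using bcf_bound[OF f] by blast
      then show ?thesis unfolding D_iff
        by (auto simp: bcf_add[OF f] bcf_scale[OF f] corner11_add corner11_scale)
    qed
    have "F (\<lambda>x\<in>corner11. ?\<psi> (b * x)) = (\<lambda>x\<in>J. f (b * l (r x)))"
      "F (\<lambda>x\<in>corner11. ?\<psi> (x * b)) = (\<lambda>x\<in>J. f (l (r x) * b))"
      using corner11_mult[OF b corner11_lr] corner11_mult[OF corner11_lr b] by (auto simp: F_def corner11_lr)
    moreover have "\<Theta> (F (\<lambda>x\<in>corner11. ?\<psi> (b * x))) = c * f b" "\<Theta> (F (\<lambda>x\<in>corner11. ?\<psi> (x * b))) = c * f b"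
      using fun_cong[OF c(1)[OF b], of ?\<psi>] fun_cong[OF c(2)[OF b], of ?\<psi>]
        D_mult[OF \<psi> b] \<psi> corner11_scale[OF b]
      unfolding BB_ops bm_canonical_def by (simp_all add: \<Phi>_def bcf_scale[OF f])
    ultimately show ?thesis by simp
  qed
  then show ?thesis using that by blast
qed


text \<open>Here \<open>c y = y \<Theta>\<close>, and the compression of \<open>\<Theta>\<close> to \<open>PAP\<close> comes from the bidual of the projective tensor
  product of \<open>PAQ\<close> and \<open>QAP\<close>.  In terms of functionals: let \<open>f\<close> be dominated by the gauge and
  attain it at \<open>y\<close>.  Then \<open>x \<mapsto> f (y P x P)\<close> vanishes on odd elements and has size at most a constant times
  \<open>norm y\<close> on products of two odd elements of the unit ball, so \<open>c f y\<close> is bounded by a constant times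
  \<open>norm y\<close>.  The constant does not depend on \<open>M\<close>, which is what the iteration needs.\<close>

lemma corner11_subset_proj_image:
  assumes c: "c \<noteq> 0"
    and scalar: "\<And>f b. bounded_cfunctional f \<Longrightarrow> b \<in> corner11 \<Longrightarrow> \<Theta> (\<lambda>x\<in>J. f (b * l (r x))) = c * f b"
  shows "corner11 \<subseteq> proj_image corner12 (peirce.corner12 l' r)"
proof -
  let ?X = corner12 and ?Y = "peirce.corner12 l' r"
  have Y: "?Y = {x. l' x = x \<and> r x = x}" by (rule peirce.corner12_def[OF swap])
  have X_scale: "a *\<^sub>C x \<in> ?X" if "x \<in> ?X" for a x
    using that by (simp add: corner12_def op_scale)
  obtain C where C: "C \<ge> 1" "\<And>x. norm (l x) \<le> C * norm x" "\<And>x. norm (r x) \<le> C * norm x"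
    using op_bound by metis
  obtain B where B: "B \<ge> 0" "\<And>f. f \<in> CZ \<Longrightarrow> cmod (\<Theta> f) \<le> B * bm_norm Z f"
    using \<Theta>_bound by blast
  show ?thesis
  proof (rule proj_image_if_gauge_norm_bounded[where K = "B * (C * C) / cmod c"])
    show "0 \<in> ?X" "0 \<in> ?Y" by (simp_all add: corner12_def Y)
    show "x - y \<in> corner11" if "x \<in> corner11" "y \<in> corner11" for x y
      using that by (simp add: corner11_def op_diff)
    show "pair_sum ps \<in> corner11" if "ps \<in> lists (?X \<times> ?Y)" for ps
      using that
      by (induction ps) (auto simp: corner11_def corner12_def Y op_add l_mult r_mult)
    show "0 \<le> B * (C * C) / cmod c" using B(1) by simp
  next
    fix y and M :: real
    assume y: "y \<in> corner11" and M: "M \<ge> 0"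
    let ?p = "gauge_norm ?X ?Y M"
    obtain f where f: "complex_linear f" "\<And>x. cmod (f x) \<le> ?p x" "f y = of_real (?p y)"
      using Hahn_Banach_complex[of ?p y] gauge_norm_triangle[OF M X_scale]
        gauge_norm_scale[OF M X_scale] by metis
    have "cmod (f x) \<le> M * norm x" for x
      using order_trans[OF f(2) gauge_norm_le_norm[OF M X_scale]] by simp
    then have bcf: "bounded_cfunctional f" using f(1) unfolding bounded_cfunctional_def by blast
    have gen: "cmod (f (y * l (r g))) \<le> C * C * norm y" if "g \<in> odd_generators" for g
    proof -
      from that consider (one) "g \<in> odd_elements"
        | (two) u v where "g = u * v" "u \<in> odd_elements" "v \<in> odd_elements" "norm u \<le> 1" "norm v \<le> 1"
        unfolding odd_generators_def by blast
      then show ?thesis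
      proof cases
        case one
        then show ?thesis using bcf_zero[OF bcf] C(1) by (simp add: odd_r)
      next
        case two
        have "l (r g) = l u * r v" by (simp add: two(1) l_mult r_mult)
        \<comment> \<open>A product of an element of \<open>PAQ\<close> and one of \<open>QAP\<close>, so the gauge controls it by norms.\<close>
        then have eq: "y * l (r g) = (y * l u) * r v" by (simp add: mult.assoc)
        have X: "y * l u \<in> ?X"
          using y two(2) by (simp add: corner11_def corner12_def l_mult r'_mult odd_l)
        have Y: "r v \<in> ?Y" using two(3) by (simp add: Y idem odd_r)
        have "?p ((y * l u) * r v) \<le> norm (y * l u) * norm (r v)"
        proof (rule gauge_norm_mult_le[OF M _ X Y])
          show "a *\<^sub>C x \<in> ?X" if "x \<in> ?X" for a x using X_scale[OF that] .
        qed
        also have "\<dots> \<le> (norm y * C) * C"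
        proof (rule mult_mono)
          have "norm (l u) \<le> C"
            using order_trans[OF C(2) mult_left_mono[OF two(4)]] C(1) by simp
          then show "norm (y * l u) \<le> norm y * C"
            using order_trans[OF norm_mult_ineq[of y "l u"] mult_left_mono[of "norm (l u)" C "norm y"]]
            by simp
          show "norm (r v) \<le> C"
            using order_trans[OF C(3) mult_left_mono[OF two(5)]] C(1) by simp
        qed (use C(1) in auto)
        finally show ?thesis using f(2)[of "y * l (r g)"] by (simp add: eq mult_ac)
      qed
    qed
    have op_y: "bounded_clinear_op (\<lambda>x. y * l (r x))"
      using clinear_op_compose[OF clinear_op_mult_left clinear_op_compose[OF op(1,2)]] .
    note F = restrict_mem[OF bcf_compose[OF bcf op_y] gen]
    have "cmod c * ?p y = cmod (c * f y)"
      using f(2)[of y] f(3) norm_ge_zero[of "f y"] by (simp add: norm_mult)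
    also have "\<dots> = cmod (\<Theta> (\<lambda>x\<in>J. f (y * l (r x))))" by (simp only: scalar[OF bcf y])
    also have "\<dots> \<le> B * (C * C * norm y)"
      using order_trans[OF B(2)[OF F(1)] mult_left_mono[OF F(2) B(1)]] by simp
    finally show "?p y \<le> B * (C * C) / cmod c * norm y"
      using c by (simp add: field_simps)
  qed
qed

lemma \<Theta>_compose_bcf:
  assumes f: "bounded_cfunctional f" and T: "bounded_clinear_op T"
  shows "bounded_cfunctional (\<lambda>x. \<Theta> (\<lambda>j\<in>J. f (x * T j)))" "bounded_cfunctional (\<lambda>x. \<Theta> (\<lambda>j\<in>J. f (T j * x)))"
proof -
  obtain B where B: "B \<ge> 0" "\<And>f. f \<in> CZ \<Longrightarrow> cmod (\<Theta> f) \<le> B * bm_norm Z f"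
    using \<Theta>_bound by blast
  obtain K where K: "K \<ge> 0" "\<And>x. cmod (f x) \<le> K * norm x" using bcf_bound[OF f] by blast
  obtain C where C: "C \<ge> 0" "\<And>x. norm (T x) \<le> norm x * C"
    using T bounded_linear.nonneg_bounded unfolding bounded_clinear_op_def by blast
  have T1: "norm (T g) \<le> C" if "g \<in> odd_generators" for g
    using order_trans[OF C(2) mult_right_mono[OF odd_generators_norm[OF that] C(1)]] by simp
  have gen: "cmod (f (x * T g)) \<le> K * C * norm x" "cmod (f (T g * x)) \<le> K * C * norm x"
    if "g \<in> odd_generators" for g x
  proof -
    have "norm (x * T g) \<le> norm x * C" "norm (T g * x) \<le> C * norm x"
      using order_trans[OF norm_mult_ineq mult_left_mono[OF T1[OF that]]]
        order_trans[OF norm_mult_ineq mult_right_mono[OF T1[OF that]]] by auto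
    then show "cmod (f (x * T g)) \<le> K * C * norm x" "cmod (f (T g * x)) \<le> K * C * norm x"
      using order_trans[OF K(2)[of "x * T g"] mult_left_mono[OF _ K(1), of _ "norm x * C"]]
        order_trans[OF K(2)[of "T g * x"] mult_left_mono[OF _ K(1), of _ "C * norm x"]]
      by (simp_all add: mult.assoc mult.commute[of C "norm x"])
  qed
  have opx: "bounded_clinear_op (\<lambda>j. x * T j)" "bounded_clinear_op (\<lambda>j. T j * x)" for x
    using clinear_op_compose[OF clinear_op_mult_left T] clinear_op_compose[OF clinear_op_mult_right T] .
  note F = restrict_mem[OF bcf_compose[OF f opx(1)] gen(1)]
    restrict_mem[OF bcf_compose[OF f opx(2)] gen(2)]
  have *: "\<Theta> (\<lambda>j\<in>J. f j + h j) = \<Theta> (\<lambda>j\<in>J. f j) + \<Theta> (\<lambda>j\<in>J. h j)"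
    if "(\<lambda>j\<in>J. f j) \<in> CZ" "(\<lambda>j\<in>J. h j) \<in> CZ" for f h
    using \<Theta>_add[OF that] by (simp cong: restrict_cong)
  have **: "\<Theta> (\<lambda>j\<in>J. c * f j) = c * \<Theta> (\<lambda>j\<in>J. f j)" if "(\<lambda>j\<in>J. f j) \<in> CZ" for f c
    using \<Theta>_scale[OF that] by (simp cong: restrict_cong)
  show "bounded_cfunctional (\<lambda>x. \<Theta> (\<lambda>j\<in>J. f (x * T j)))"
  proof (rule bcfI)
    show "cmod (\<Theta> (\<lambda>j\<in>J. f (x * T j))) \<le> (B * (K * C)) * norm x" for x
      using order_trans[OF B(2)[OF F(1)] mult_left_mono[OF F(2) B(1)]] by (simp add: mult_ac)
    show "\<Theta> (\<lambda>j\<in>J. f ((x + y) * T j)) = \<Theta> (\<lambda>j\<in>J. f (x * T j)) + \<Theta> (\<lambda>j\<in>J. f (y * T j))" for x y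
      unfolding distrib_right bcf_add[OF f] by (rule *[OF F(1) F(1)])
    show "\<Theta> (\<lambda>j\<in>J. f ((c *\<^sub>C x) * T j)) = c * \<Theta> (\<lambda>j\<in>J. f (x * T j))" for c x
      unfolding mult_scaleC_left bcf_scale[OF f] by (rule **[OF F(1)])
  qed
  show "bounded_cfunctional (\<lambda>x. \<Theta> (\<lambda>j\<in>J. f (T j * x)))"
  proof (rule bcfI)
    show "cmod (\<Theta> (\<lambda>j\<in>J. f (T j * x))) \<le> (B * (K * C)) * norm x" for x
      using order_trans[OF B(2)[OF F(3)] mult_left_mono[OF F(4) B(1)]] by (simp add: mult_ac)
    show "\<Theta> (\<lambda>j\<in>J. f (T j * (x + y))) = \<Theta> (\<lambda>j\<in>J. f (T j * x)) + \<Theta> (\<lambda>j\<in>J. f (T j * y))" for x y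
      unfolding distrib_left bcf_add[OF f] by (rule *[OF F(3) F(3)])
    show "\<Theta> (\<lambda>j\<in>J. f (T j * (c *\<^sub>C x))) = c * \<Theta> (\<lambda>j\<in>J. f (T j * x))" for c x
      unfolding mult_scaleC_right bcf_scale[OF f] by (rule **[OF F(3)])
  qed
qed

text \<open>If both compressions of \<open>\<Theta>\<close> to \<open>PAP\<close> and \<open>QAQ\<close> act as zero, then \<open>a \<Theta>\<close> and \<open>\<Theta> a\<close> vanish on the
  functionals that live on \<open>PAQ\<close>, for \<open>a\<close> in \<open>PAQ\<close>.  For \<open>a = a' b\<close> with \<open>b\<close> in \<open>QAQ\<close> this is immediate,
  as \<open>a \<Theta> = a' (b \<Theta>)\<close>.  The weak right unit replaces such a factorization: the functional
  \<open>h x = \<Theta> (j \<mapsto> f (x Q j Q))\<close> satisfies \<open>h (a x) = 0\<close> for all \<open>x\<close>, since only \<open>Q x Q\<close> contributes, and so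
  \<open>h a = 0\<close>.  The other side is the mirror image.\<close>

lemma \<Theta>_annihilates_corner12:
  assumes amenable: "amenable (UNIV :: 'a set)" and f: "bounded_cfunctional f" and a: "a \<in> corner12"
    and kill11: "\<And>f b. bounded_cfunctional f \<Longrightarrow> b \<in> corner11 \<Longrightarrow> \<Theta> (\<lambda>x\<in>J. f (l (r x) * b)) = 0"
    and kill22: "\<And>f b. bounded_cfunctional f \<Longrightarrow> b \<in> peirce.corner11 l' r' \<Longrightarrow> \<Theta> (\<lambda>x\<in>J. f (b * l' (r' x))) = 0"
  shows "\<Theta> (\<lambda>x\<in>J. f (l (r' (a * x)))) = 0" "\<Theta> (\<lambda>x\<in>J. f (l (r' (x * a)))) = 0"
proof -
  have la: "l a = a" and ra: "r' a = a" using a by (auto simp: corner12_def)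
  have "\<Theta> (\<lambda>j\<in>J. f (a * l' (r' j))) = 0"
  proof (rule amenable_weak_right_unit[OF amenable \<Theta>_compose_bcf(1)[OF f clinear_op_compose[OF op(3,4)]]])
    fix x
    have "(a * x) * l' (r' j) = a * (l' (r' x) * l' (r' j))" for j
    proof -
      have "(a * x) * l' (r' j) = r' a * r' x * l' (r' j)"
        using balance'[of "a * x" "l' (r' j)"] by (simp add: r'_mult idem ra)
      also have "\<dots> = a * l' (r' x) * l' (r' j)" using balance'[of a "r' x"] by (simp add: ra)
      finally show ?thesis by (simp add: mult.assoc)
    qed
    moreover have "l' (r' x) \<in> peirce.corner11 l' r'"
      by (simp add: peirce.corner11_def[OF swap] peirce_simps)
    ultimately show "\<Theta> (\<lambda>j\<in>J. f ((a * x) * l' (r' j))) = 0"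
      using kill22[OF bcf_compose[OF f clinear_op_mult_left[of a]]] by simp
  qed
  moreover have "l (r' (a * j)) = a * l' (r' j)" for j
    using balance'[of a "r' j"] by (simp add: l_mult r'_mult la ra)
  ultimately show "\<Theta> (\<lambda>x\<in>J. f (l (r' (a * x)))) = 0" by simp
  have "\<Theta> (\<lambda>j\<in>J. f (l (r j) * a)) = 0"
  proof (rule amenable_weak_left_unit[OF amenable \<Theta>_compose_bcf(2)[OF f clinear_op_compose[OF op(1,2)]]])
    fix x
    have "l (r j) * (x * a) = (l (r j) * l (r x)) * a" for j
    proof -
      have "l (r j) * (x * a) = l (r j) * (l x * l a)"
        using balance[of "l (r j)" "x * a"] by (simp add: l_mult comm idem la)
      also have "l x * l a = l (r x) * a" using balance[of "l x" a] by (simp add: comm la)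
      finally show ?thesis by (simp add: mult.assoc)
    qed
    moreover have "l (r x) \<in> corner11" by (simp add: corner11_def peirce_simps)
    ultimately show "\<Theta> (\<lambda>j\<in>J. f (l (r j) * (x * a))) = 0"
      using kill11[OF bcf_compose[OF f clinear_op_mult_right[of a]]] by simp
  qed
  moreover have "l (r' (j * a)) = l (r j) * a" for j
    using balance[of "l j" a] by (simp add: l_mult r'_mult la ra comm)
  ultimately show "\<Theta> (\<lambda>x\<in>J. f (l (r' (x * a)))) = 0" by simp
qed

end

subsection \<open>The implementing functional decides between the corners\<close>

text \<open>The derivation is \<open>a \<mapsto> a P - P a\<close>.  It vanishes on both diagonal corners, is \<open>- a\<close> on \<open>PAQ\<close> and \<open>a\<close> on
  \<open>QAP\<close>.  The scalars by which the implementing functional acts on the two diagonal corners decide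
  the case.\<close>

theorem peirce_dichotomy:
  assumes amenable: "amenable (UNIV :: 'a set)"
    and tvc1: "trivial_virtual_centre corner11" and tvc2: "trivial_virtual_centre (peirce.corner11 l' r')"
  shows "corner11 = proj_image corner12 (peirce.corner12 l' r) \<or>
    peirce.corner11 l' r' = proj_image (peirce.corner12 l' r) corner12 \<or> (corner12 = {0} \<and> peirce.corner12 l' r = {0})"
proof -
  interpret swapped: peirce l' r' l r by (rule swap)
  define d where "d a = r a - l a" for a
  have d_odd: "d a \<in> odd_elements" for a
    using op_diff(3)[of 0 "l (r' a)"] by (simp add: odd_elements_def d_def op_diff peirce_simps)
  have d_mem_J: "d a \<in> J" for a
    using odd_hull[OF d_odd order_refl] by (metis cspan_base cspan_scale)
  obtain C where C: "C \<ge> 1" "\<And>x. norm (l x) \<le> C * norm x" "\<And>x. norm (r x) \<le> C * norm x"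
    using op_bound by metis
  obtain \<Theta> where \<Theta>: "\<Theta> \<in> bm_carrier (bm_dual Z)"
    and inner: "\<And>a f. f \<in> CZ \<Longrightarrow> f (d a) = \<Theta> (\<lambda>x\<in>J. f (a * x)) - \<Theta> (\<lambda>x\<in>J. f (x * a))"
  proof (rule odd_module.amenable_implements[OF amenable, of d "2 * C"])
    fix \<Theta>
    assume "\<Theta> \<in> bm_carrier (bm_dual Z)"
      "\<And>a f. f \<in> CZ \<Longrightarrow> f (d a) = \<Theta> (\<lambda>x\<in>J. f (a * x)) - \<Theta> (\<lambda>x\<in>J. f (x * a))"
    then show thesis by (rule that)
  next
    show "d (a + b) = d a + d b" "d (c *\<^sub>C a) = c *\<^sub>C d a" for a b c
      using scaleC_add_right[of c "r a" "- l a"]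
      by (simp_all add: d_def op_add op_scale scaleC_minus_right)
    show "d (a * b) = a * d b + d a * b" for a b
      using balance[of a b] by (simp add: d_def l_mult r_mult algebra_simps)
    show "\<exists>c. \<exists>g\<in>odd_generators. d a = c *\<^sub>C g \<and> cmod c \<le> 2 * C * norm a" for a
    proof -
      have "norm (d a) \<le> 2 * C * norm a"
        unfolding d_def using norm_triangle_ineq4[of "r a" "l a"] C(2,3)[of a] by simp
      then obtain g where "g \<in> odd_generators" "d a = of_real (2 * C * norm a) *\<^sub>C g"
        using odd_hull[OF d_odd] by blast
      then show ?thesis using C(1) by (intro exI bexI conjI) (auto simp: norm_mult)
    qed
  qed
  have \<Theta>': "\<Theta> \<in> bm_carrier (bm_dual swapped.Z)" using \<Theta> by (simp add: swap_odd_generators)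
  \<comment> \<open>Where the derivation vanishes, \<open>\<Theta>\<close> commutes.\<close>
  have central: "\<Theta> (\<lambda>x\<in>J. f (b * x)) = \<Theta> (\<lambda>x\<in>J. f (x * b))" if "d b = 0" "f \<in> CZ" for b f
  proof -
    have "f 0 = 0" using odd_module.carrier_scale[OF that(2) odd_module.zero_mem_J, of 0] by simp
    then show ?thesis using inner[OF that(2), of b] that(1) by simp
  qed
  have d1: "d b = 0" if "b \<in> corner11" for b using that by (simp add: corner11_def d_def)
  have d2: "d b = 0" if "b \<in> swapped.corner11" for b
    using that orth(1,3)[of b] by (simp add: swapped.corner11_def d_def)
  obtain c1 where c1: "\<And>f b. bounded_cfunctional f \<Longrightarrow> b \<in> corner11 \<Longrightarrow> \<Theta> (\<lambda>x\<in>J. f (b * l (r x))) = c1 * f b"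
    "\<And>f b. bounded_cfunctional f \<Longrightarrow> b \<in> corner11 \<Longrightarrow> \<Theta> (\<lambda>x\<in>J. f (l (r x) * b)) = c1 * f b"
    using virtual_centre_scalar[OF \<Theta> tvc1] central d1 by metis
  obtain c2 where c2: "\<And>f b. bounded_cfunctional f \<Longrightarrow> b \<in> swapped.corner11 \<Longrightarrow> \<Theta> (\<lambda>x\<in>J. f (b * l' (r' x))) = c2 * f b"
    "\<And>f b. bounded_cfunctional f \<Longrightarrow> b \<in> swapped.corner11 \<Longrightarrow> \<Theta> (\<lambda>x\<in>J. f (l' (r' x) * b)) = c2 * f b"
    using swapped.virtual_centre_scalar[OF \<Theta>' tvc2, unfolded swap_odd_generators] central d2
    by metis
  consider "c1 \<noteq> 0" | "c2 \<noteq> 0" | "c1 = 0" "c2 = 0" by blast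
  then show ?thesis
  proof cases
    case 1
    have "corner11 \<subseteq> proj_image corner12 swapped.corner12"
      by (rule corner11_subset_proj_image[OF \<Theta> 1]) (rule c1(1))
    then show ?thesis using proj_image_subset_corner11 by blast
  next
    case 2
    have "swapped.corner11 \<subseteq> proj_image swapped.corner12 corner12"
      by (rule swapped.corner11_subset_proj_image[OF \<Theta>' 2, unfolded swap_odd_generators]) (rule c2(1))
    then show ?thesis using swapped.proj_image_subset_corner11 by blast
  next
    case 3
    have kill:
      "\<Theta> (\<lambda>x\<in>J. f (b * l (r x))) = 0" "\<Theta> (\<lambda>x\<in>J. f (l (r x) * b)) = 0"
      if "bounded_cfunctional f" "b \<in> corner11" for f b
      using c1[OF that] 3 by simp_all
    have kill':
      "\<Theta> (\<lambda>x\<in>J. f (b * l' (r' x))) = 0" "\<Theta> (\<lambda>x\<in>J. f (l' (r' x) * b)) = 0"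
      if "bounded_cfunctional f" "b \<in> swapped.corner11" for f b
      using c2[OF that] 3 by simp_all
    have corner12_zero: "a = 0" if a: "a \<in> corner12" for a
    proof (rule bcf_separates)
      fix f :: "'a \<Rightarrow> complex" assume f: "bounded_cfunctional f"
      have mem: "(\<lambda>x\<in>J. f (l (r' x))) \<in> CZ"
        using bcf_restrict_mem[OF bcf_compose[OF f clinear_op_compose[OF op(1,4)]]] .
      have da: "d a = - a" using a orth(3)[of a] by (auto simp: corner12_def d_def)
      note zero = \<Theta>_annihilates_corner12[OF \<Theta> amenable f a kill(2) kill'(1)]
      have "(\<lambda>x\<in>J. (\<lambda>x\<in>J. f (l (r' x))) (a * x)) = (\<lambda>x\<in>J. f (l (r' (a * x))))"
        "(\<lambda>x\<in>J. (\<lambda>x\<in>J. f (l (r' x))) (x * a)) = (\<lambda>x\<in>J. f (l (r' (x * a))))"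
        by (auto simp: odd_module.L_mem_J odd_module.R_mem_J)
      then have "(\<lambda>x\<in>J. f (l (r' x))) (d a) = 0"
        using inner[OF mem, of a] zero by (simp only: diff_self)
      moreover note d_mem_J[of a]
      ultimately have "f (l (r' (- a))) = 0" by (simp add: da)
      then show "f a = 0"
        using a op_diff(4)[of 0 a] op_diff(1)[of 0 a] by (simp add: corner12_def bcf_minus[OF f])
    qed
    have corner21_zero: "a = 0" if a: "a \<in> swapped.corner12" for a
    proof (rule bcf_separates)
      fix f :: "'a \<Rightarrow> complex" assume f: "bounded_cfunctional f"
      have mem: "(\<lambda>x\<in>J. f (l' (r x))) \<in> CZ"
        using bcf_restrict_mem[OF bcf_compose[OF f clinear_op_compose[OF op(3,2)]]] .
      have da: "d a = a" using a orth(1)[of a] by (simp add: swapped.corner12_def d_def)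
      note zero = swapped.\<Theta>_annihilates_corner12[OF \<Theta>' amenable f a, unfolded swap_odd_generators,
        OF kill'(2) kill(1)]
      have "(\<lambda>x\<in>J. (\<lambda>x\<in>J. f (l' (r x))) (a * x)) = (\<lambda>x\<in>J. f (l' (r (a * x))))"
        "(\<lambda>x\<in>J. (\<lambda>x\<in>J. f (l' (r x))) (x * a)) = (\<lambda>x\<in>J. f (l' (r (x * a))))"
        by (auto simp: odd_module.L_mem_J odd_module.R_mem_J)
      then have "(\<lambda>x\<in>J. f (l' (r x))) (d a) = 0"
        using inner[OF mem, of a] zero by (simp only: diff_self)
      moreover note d_mem_J[of a]
      ultimately have "f (l' (r a)) = 0" by (simp add: da)
      then show "f a = 0" using a by (simp add: swapped.corner12_def)
    qed
    have "corner12 = {0}" "swapped.corner12 = {0}"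
      using corner12_zero corner21_zero by (auto simp: corner12_def swapped.corner12_def)
    then show ?thesis by blast
  qed
qed

end

theorem theorem6p8:
  fixes P1 P2 :: "'a::complex_banach_algebra dmult"
    and A11 A12 A21 A22 :: "'a set"
  assumes "P1 \<in> double_multipliers"
    and "dm_mult P1 P1 = P1"
    and "P2 = dm_minus dm_one P1"
    and "A11 = corner P1 P1" and "A12 = corner P1 P2"
    and "A21 = corner P2 P1" and "A22 = corner P2 P2"
    and "amenable (UNIV :: 'a set)"
    and "trivial_virtual_centre A11" and "trivial_virtual_centre A22"
    and "\<not> (A21 = {0} \<and> A12 = {0})"
  shows "A11 = proj_image A12 A21 \<or> A22 = proj_image A21 A12"
proof -
  obtain l r where P1: "P1 = (l, r)" by (cases P1)
  define l' where "l' a = a - l a" for a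
  define r' where "r' a = a - r a" for a
  have P2: "P2 = (l', r')"
    by (auto simp: assms(3) P1 dm_minus_def dm_one_def l'_def r'_def fun_eq_iff)
  have dm: "bounded_clinear_op l" "bounded_clinear_op r" "l \<circ> r = r \<circ> l"
    "\<And>a b. l (a * b) = l a * b" "\<And>a b. r (a * b) = a * r b" "\<And>a b. a * l b = r a * b"
    using assms(1) by (auto simp: P1 double_multipliers_def)
  have lr: "r (l x) = l (r x)" for x using dm(3) by (simp add: fun_eq_iff)
  have idem: "l (l x) = l x" "r (r x) = r x" for x
    using assms(2) by (simp_all add: P1 dm_mult_def fun_eq_iff)
  have diff: "l (x - y) = l x - l y" "r (x - y) = r x - r y" for x y
    using dm(1,2) by (simp_all add: bounded_clinear_op_def bounded_linear.linear linear_diff)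
  have co: "bounded_clinear_op (\<lambda>x. x - T x)" if "bounded_clinear_op T" for T :: "'a \<Rightarrow> 'a"
  proof -
    have "c *\<^sub>C (x - y) = c *\<^sub>C x - c *\<^sub>C y" for c and x y :: 'a
      using scaleC_add_right[of c x "- y"] by (simp add: scaleC_minus_right)
    then show ?thesis
      using that by (auto simp: bounded_clinear_op_def intro: bounded_linear_sub bounded_linear_ident)
  qed
  have op': "bounded_clinear_op l'" "bounded_clinear_op r'"
    using co[OF dm(1)] co[OF dm(2)] by (simp_all add: l'_def[abs_def] r'_def[abs_def])
  interpret peirce l r l' r'
    by unfold_locales
      (simp_all add: dm(1,2,4-6) op' lr idem diff l'_def r'_def left_diff_distrib right_diff_distrib)
  interpret swapped: peirce l' r' l r by (rule swap)
  have range: "{S (T a) |a. True} = {x. S x = x \<and> T x = x}"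
    if "\<And>x. S (S x) = S x" "\<And>x. T (T x) = T x" "\<And>x. S (T x) = T (S x)" for S T :: "'a \<Rightarrow> 'a"
  proof (intro set_eqI iffI)
    fix x assume "x \<in> {S (T a) |a. True}"
    then show "x \<in> {x. S x = x \<and> T x = x}" using that by auto
  next
    fix x assume "x \<in> {x. S x = x \<and> T x = x}"
    then show "x \<in> {S (T a) |a. True}" by (intro CollectI exI[of _ x]) simp
  qed
  have corners: "A11 = corner11" "A12 = corner12" "A21 = swapped.corner12" "A22 = swapped.corner11"
    unfolding assms(4-7) corner_def P1 P2 corner11_def corner12_def
      swapped.corner11_def swapped.corner12_def fst_conv snd_conv
    by (rule range; simp add: peirce_simps)+
  show ?thesis
    using peirce_dichotomy assms(8-11) unfolding corners by blast
qed

end
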